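(* Let $1<t<3/2$ and let $\mathcal D$ be a dyadic system on $\mathbb T$. Let $\omega$ be a weight on $[0,1)$ for which there is a constant $c>0$ with $\omega(r)\ge c$ for all $r\in[0,1/2)$, and let $\omega(z):=\omega(|z|)$ denote the associated radial weight on $\mathbb D$. Then $\mathcal M_t^{\mathcal D}: L^{\frac{1}{3-2t}}(\mathbb D,\omega)\to L^{1,\infty}(\mathbb D)$ is bounded if and only if $$\sup_{k\ge 0}\ 2^k\int_{1-\frac{1}{2^k}}^{1-\frac{1}{2^{k+1}}}\frac{1}{\omega^{\frac{3-2t}{2t-2}}(r)}\,dr<+\infty .$$
   Context: $\mathbb D$ is the open unit disc in $\mathbb C$, $dA$ is normalized area measure on $\mathbb D$, $|E|$ denotes the $dA$-measure of $E\subseteq\mathbb D$. $\mathbb T$ is the unit circle with arc length normalized so that $|\mathbb T|=1$; $|I|$ is the normalized length of an arc $I$. A dyadic system on $\mathbb T$ is a collection of arcs $\mathcal D=\bigcup_{k\ge0}\mathcal D_k$ where each $\mathcal D_k$ consists of $2^k$ disjoint arcs of length $2^{-k}$ with union $\mathbb T$, and each arc of $\mathcal D_k$ is the union of two arcs of $\mathcal D_{k+1}$. The Carleson box of an arc $I\subseteq\mathbb T$ is $Q_I:=\{z\in\mathbb D: z/|z|\in I,\ 1-|I|\le|z|<1\}$ (the single point $z=0$ is a null set and plays no role). The dyadic hypersingular maximal operator is $$\mathcal M_t^{\mathcal D}f(z):=\sup_{I\in\mathcal D,\ z\in Q_I}\frac{1}{|Q_I|^t}\int_{Q_I}|f(w)|\,dA(w).$$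 A weight is a nonnegative locally integrable function. $L^p(\mathbb D,\omega)$ is the space of measurable $f$ with $\|f\|_{L^p(\mathbb D,\omega)}^p:=\int_{\mathbb D}|f|^p\omega\,dA<\infty$. $L^{1,\infty}(\mathbb D)$ is weak $L^1$ with respect to $dA$: $\|f\|_{L^{1,\infty}(\mathbb D)}:=\sup_{\lambda>0}\lambda\,|\{z\in\mathbb D:|f(z)|>\lambda\}|$. Boundedness means $\|\mathcal M_t^{\mathcal D}f\|_{L^{1,\infty}(\mathbb D)}\le C\|f\|_{L^{\frac1{3-2t}}(\mathbb D,\omega)}$ for all $f$, with $C$ independent of $f$. *)

theory Defs
  imports "HOL-Analysis.Analysis"
begin

definition disc_area :: "complex measure" where
  "disc_area = scale_measure (ennreal (1 / pi)) (lebesgue_on (ball 0 1))"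

text \<open>An arc of the unit circle may contain any of its end points; the whole circle is an arc.\<close>

definition circle_arc :: "complex set \<Rightarrow> bool" where
  "circle_arc I \<longleftrightarrow> (\<exists>J::real set. is_interval J \<and> I = (\<lambda>\<theta>. cis (2 * pi * \<theta>)) ` J)"

definition arc_length :: "complex set \<Rightarrow> real" where
  "arc_length I = measure lebesgue {\<theta>\<in>{0..<1}. cis (2 * pi * \<theta>) \<in> I}"

definition dyadic_system :: "(nat \<Rightarrow> complex set set) \<Rightarrow> bool" where
  "dyadic_system \<D> \<longleftrightarrow>
     (\<forall>k. card (\<D> k) = 2 ^ k \<and> disjoint (\<D> k) \<and> \<Union>(\<D> k) = sphere 0 1 \<and>
          (\<forall>I\<in>\<D> k. circle_arc I \<and> arc_length I = 1 / 2 ^ k \<and>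
             (\<exists>J\<in>\<D> (Suc k). \<exists>K\<in>\<D> (Suc k). J \<noteq> K \<and> I = J \<union> K)))"

text \<open>The origin lies in no Carleson box, because \<open>0 / 0 = 0\<close> is not on the circle.\<close>

definition carleson_box :: "complex set \<Rightarrow> complex set" where
  "carleson_box I = {z \<in> ball 0 1. z / of_real (norm z) \<in> I \<and> 1 - arc_length I \<le> norm z}"

text \<open>The maximal function takes values in \<^typ>\<open>ennreal\<close>: no integrability of \<open>f\<close> is
  presupposed. Its value at the origin is \<open>Sup {} = 0\<close>.\<close>

definition dyadic_maximal ::
    "(nat \<Rightarrow> complex set set) \<Rightarrow> real \<Rightarrow> (complex \<Rightarrow> complex) \<Rightarrow> complex \<Rightarrow> ennreal" where
  "dyadic_maximal \<D> t f z =
     (SUP I \<in> {I \<in> (\<Union>k. \<D> k). z \<in> carleson_box I}.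
        ennreal (1 / measure disc_area (carleson_box I) powr t) *
        (\<integral>\<^sup>+w\<in>carleson_box I. ennreal (norm (f w)) \<partial>disc_area))"

text \<open>Only the values of the weight on \<open>[0,1)\<close> matter.\<close>

definition weight_on_unit_interval :: "(real \<Rightarrow> real) \<Rightarrow> bool" where
  "weight_on_unit_interval \<omega> \<longleftrightarrow>
     (\<forall>r\<in>{0..<1}. 0 \<le> \<omega> r) \<and>
     (\<forall>K. compact K \<and> K \<subseteq> {0..<1} \<longrightarrow> set_integrable lebesgue K \<omega>)"

definition Lp_integral :: "real \<Rightarrow> (complex \<Rightarrow> real) \<Rightarrow> (complex \<Rightarrow> complex) \<Rightarrow> ennreal" where
  "Lp_integral p v f = (\<integral>\<^sup>+z. ennreal (norm (f z) powr p * v z) \<partial>disc_area)"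

definition Lp_space :: "real \<Rightarrow> (complex \<Rightarrow> real) \<Rightarrow> (complex \<Rightarrow> complex) set" where
  "Lp_space p v = {f \<in> borel_measurable disc_area. Lp_integral p v f < \<infinity>}"

definition Lp_norm :: "real \<Rightarrow> (complex \<Rightarrow> real) \<Rightarrow> (complex \<Rightarrow> complex) \<Rightarrow> real" where
  "Lp_norm p v f = enn2real (Lp_integral p v f) powr (1 / p)"

definition weak_L1_norm :: "(complex \<Rightarrow> ennreal) \<Rightarrow> ennreal" where
  "weak_L1_norm g =
     (SUP s\<in>{(0::real)<..}. ennreal s * emeasure disc_area {z \<in> ball 0 1. g z > ennreal s})"

definition bounded_Lp_weak_L1 ::
    "((complex \<Rightarrow> complex) \<Rightarrow> complex \<Rightarrow> ennreal) \<Rightarrow> real \<Rightarrow> (complex \<Rightarrow> real) \<Rightarrow> bool" where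
  "bounded_Lp_weak_L1 T p v \<longleftrightarrow>
     (\<exists>C\<ge>0. \<forall>f\<in>Lp_space p v. weak_L1_norm (T f) \<le> ennreal (C * Lp_norm p v f))"

end

theory Submission
  imports Defs
begin

text \<open>
  Put \<open>p = 1 / (3 - 2 t)\<close>, with conjugate exponent \<open>p' = 1 / (2 t - 2)\<close>, and let
  \<open>\<sigma> = \<omega> powr (- (p' / p))\<close> be the dual weight. The condition of the theorem says that for some
  \<open>a\<close> the integral of \<open>\<sigma>\<close> over the \<open>k\<close>-th dyadic interval of radii is at most
  \<open>a / 2 ^ k\<close>. Everything rests on one computation: a Carleson box \<open>Q\<close> over an arc of length
  \<open>d = 1 / 2 ^ k\<close> has area between \<open>d\<^sup>2\<close> and \<open>2 d\<^sup>2\<close>, and in polar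
  coordinates (\<open>disc_polar\<close>) a radial function has over \<open>Q\<close> the integral \<open>d\<close> times a
  one-dimensional integral over \<open>[1 - d, 1)\<close>.

  Sufficiency. The superlevel set of the maximal function at height \<open>l\<close> is a union of boxes with
  \<open>l |Q| powr t < \<integral>|f|\<close>, and by dyadic nestedness it is covered by such boxes over pairwise
  disjoint arcs (\<open>emeasure_Union_boxes_le\<close>). For these, \<open>l \<Sum>|Q|\<close> is at most
  \<open>\<Sum> |Q| powr (1 - t) * \<integral>|f|\<close>, and Hoelder's inequality, in the guise of Young's inequality with a
  parameter, bounds this by the norm of \<open>f\<close> times \<open>(\<Sum> |Q| powr (- 1 / 2) * \<integral>\<sigma>) powr (1 / p')\<close>.
  By the hypothesis, the integral of \<open>\<sigma>\<close> over \<open>Q\<close> is at most of order \<open>d\<^sup>2\<close>, so each summand is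
  at most of order \<open>d\<close>, the length of the arc; the arcs are disjoint, hence the sum is bounded
  (\<open>box_average_le\<close>, \<open>weak_type_estimate\<close>).

  Necessity. The extremal function of Hoelder's inequality is the dual weight: for \<open>k \<ge> 1\<close>, test
  the inequality with \<open>\<sigma>\<close> restricted to the \<open>k\<close>-th annulus, regularized so as to be bounded. Since
  it is radial, all the boxes of generation \<open>k\<close> see the same average, and the maximal function is large
  on the whole outer annulus (\<open>regularized_dual_integral_le\<close>). Removing the regularization by monotone
  convergence gives the condition for \<open>k \<ge> 1\<close>; for \<open>k = 0\<close> it is the assumption that the weight is
  bounded below near the origin.
\<close>

section \<open>Rotations and polar coordinates in the plane\<close>

lemma nn_integral_translate:
  fixes f :: "'a::euclidean_space \<Rightarrow> ennreal"
  assumes [measurable]: "f \<in> borel_measurable borel"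
  shows "(\<integral>\<^sup>+x. f (x + c) \<partial>lborel) = (\<integral>\<^sup>+x. f x \<partial>lborel)"
  by (subst (2) lborel_distr_plus[symmetric, of c]) (simp add: nn_integral_distr add.commute)

lemma borel_measurable_cis [measurable]: "(\<lambda>\<theta>. cis (2 * pi * \<theta>)) \<in> borel_measurable borel"
  by (intro borel_measurable_continuous_onI continuous_intros)

lemma borel_measurable_sgn_complex [measurable]: "(sgn :: complex \<Rightarrow> complex) \<in> borel_measurable borel"
  unfolding sgn_div_norm[abs_def] by measurable

text \<open>
  Uniqueness of Haar measure, in the form needed here: the rotated measure is translation
  invariant, and Tonelli's theorem applied to \<open>indicator A (u x) * indicator B y\<close>, with the
  translation \<open>y \<mapsto> y - u x\<close> moved from one factor to the other, compares it with Lebesgue measure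
  up to the measure of the unit ball \<open>B\<close>, which is the same for both.
\<close>

lemma lborel_rotate:
  fixes u :: complex
  assumes u: "norm u = 1"
  shows "distr lborel lborel (\<lambda>z. u * z) = (lborel :: complex measure)"
proof (rule measure_eqI)
  fix A :: "complex set" assume "A \<in> sets (distr lborel lborel (\<lambda>z. u * z))"
  then have A [measurable]: "A \<in> sets borel" by simp
  define B :: "complex set" where "B = ball 0 1"
  have [measurable]: "B \<in> sets borel" by (simp add: B_def)
  have u0: "u \<noteq> 0" using u by auto
  have "emeasure lborel B * (\<integral>\<^sup>+x. indicator A (u * x) \<partial>lborel)
      = (\<integral>\<^sup>+x. indicator A (u * x) * (\<integral>\<^sup>+y. indicator B y \<partial>lborel) \<partial>lborel)"
    by (subst nn_integral_multc) (auto simp: mult.commute)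
  also have "\<dots> = (\<integral>\<^sup>+x. indicator A (u * x) * (\<integral>\<^sup>+y. indicator B (y + (- u * x)) \<partial>lborel) \<partial>lborel)"
    by (subst nn_integral_translate) auto
  also have "\<dots> = (\<integral>\<^sup>+x. (\<integral>\<^sup>+y. indicator A (u * x) * indicator B (y + (- u * x)) \<partial>lborel) \<partial>lborel)"
    by (intro nn_integral_cong nn_integral_cmult[symmetric]) measurable
  also have "\<dots> = (\<integral>\<^sup>+y. (\<integral>\<^sup>+x. indicator A (u * x) * indicator B (y + (- u * x)) \<partial>lborel) \<partial>lborel)"
    by (rule lborel_pair.Fubini') measurable
  also have "\<dots> = (\<integral>\<^sup>+y. (\<integral>\<^sup>+x. indicator A (u * (x + y / u))
      * indicator B (y + (- u * (x + y / u))) \<partial>lborel) \<partial>lborel)"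
    by (intro nn_integral_cong nn_integral_translate[symmetric]) measurable
  also have "\<dots> = (\<integral>\<^sup>+y. (\<integral>\<^sup>+x. indicator A (u * x + y) * indicator B x \<partial>lborel) \<partial>lborel)"
    using u0 u by (intro nn_integral_cong) (auto simp: indicator_def B_def algebra_simps norm_mult)
  also have "\<dots> = (\<integral>\<^sup>+x. (\<integral>\<^sup>+y. indicator A (u * x + y) * indicator B x \<partial>lborel) \<partial>lborel)"
    by (rule lborel_pair.Fubini') measurable
  also have "\<dots> = (\<integral>\<^sup>+x. (\<integral>\<^sup>+y. indicator A (y + u * x) \<partial>lborel) * indicator B x \<partial>lborel)"
    by (subst nn_integral_multc[symmetric]) (auto simp: add.commute)
  also have "\<dots> = (\<integral>\<^sup>+x. (\<integral>\<^sup>+y. indicator A y \<partial>lborel) * indicator B x \<partial>lborel)"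
    by (subst nn_integral_translate) auto
  also have "\<dots> = emeasure lborel B * emeasure lborel A"
    by (subst nn_integral_cmult) (auto simp: mult.commute)
  finally have "emeasure lborel B * (\<integral>\<^sup>+x. indicator A (u * x) \<partial>lborel)
      = emeasure lborel B * emeasure lborel A" .
  moreover have "emeasure lborel B \<noteq> 0" "emeasure lborel B \<noteq> \<infinity>"
    using emeasure_lborel_ball_finite[of "0::complex" 1]
        by (auto simp: B_def emeasure_ball unit_ball_vol_2)
  ultimately have "(\<integral>\<^sup>+x. indicator A (u * x) \<partial>lborel) = emeasure lborel A"
    by (simp add: ennreal_mult_cancel_left)
  then have "(\<integral>\<^sup>+x. indicator A x \<partial>distr lborel lborel (\<lambda>z. u * z)) = emeasure lborel A"
    by (subst nn_integral_distr) auto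
  then show "emeasure (distr lborel lborel (\<lambda>z. u * z)) A = emeasure lborel A"
    by simp
qed simp

text \<open>
  The part \<open>{1..<1 + s}\<close> of the shifted period is moved back to \<open>{0..<s}\<close> by periodicity.
\<close>

lemma nn_integral_shift_periodic:
  fixes g :: "real \<Rightarrow> ennreal"
  assumes [measurable]: "g \<in> borel_measurable borel" and per: "\<And>x. g (x + 1) = g x"
    and s: "0 \<le> s" "s < 1"
  shows "(\<integral>\<^sup>+x\<in>{0..<1}. g (x + s) \<partial>lborel) = (\<integral>\<^sup>+x\<in>{0..<1}. g x \<partial>lborel)"
proof -
  have "(\<integral>\<^sup>+x\<in>{0..<1}. g (x + s) \<partial>lborel) = (\<integral>\<^sup>+x. g (x + s) * indicator {s..<1+s} (x + s) \<partial>lborel)"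
    by (intro nn_integral_cong) (auto simp: indicator_def)
  also have "\<dots> = (\<integral>\<^sup>+x. g x * indicator {s..<1+s} x \<partial>lborel)"
    by (rule nn_integral_translate) auto
  also have "\<dots> = (\<integral>\<^sup>+x. g x * indicator {s..<1} x + g x * indicator {1..<1+s} x \<partial>lborel)"
    using s by (intro nn_integral_cong) (auto simp: indicator_def)
  also have "\<dots> = (\<integral>\<^sup>+x. g x * indicator {s..<1} x \<partial>lborel) + (\<integral>\<^sup>+x. g x * indicator {1..<1+s} x
      \<partial>lborel)"
    by (rule nn_integral_add) auto
  also have "(\<integral>\<^sup>+x. g x * indicator {1..<1+s} x \<partial>lborel)
      = (\<integral>\<^sup>+x. g (x + 1) * indicator {1..<1+s} (x + 1) \<partial>lborel)"
    by (rule nn_integral_translate[symmetric]) auto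
  also have "\<dots> = (\<integral>\<^sup>+x. g x * indicator {0..<s} x \<partial>lborel)"
    by (intro nn_integral_cong) (auto simp: indicator_def per)
  also have "(\<integral>\<^sup>+x. g x * indicator {s..<1} x \<partial>lborel) + \<dots>
      = (\<integral>\<^sup>+x. g x * indicator {s..<1} x + g x * indicator {0..<s} x \<partial>lborel)"
    by (rule nn_integral_add[symmetric]) auto
  also have "\<dots> = (\<integral>\<^sup>+x\<in>{0..<1}. g x \<partial>lborel)"
    using s by (intro nn_integral_cong) (auto simp: indicator_def)
  finally show ?thesis .
qed

text \<open>
  Whatever the point \<open>u\<close> of the circle, the proportion of the rotations that carry it into \<open>I\<close>
  is the length of \<open>I\<close>: with \<open>u\<close> at angle \<open>s\<close> this is the shift by \<open>s\<close> of a periodic function.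
\<close>

lemma arc_length_average:
  fixes u :: complex
  assumes [measurable]: "I \<in> sets borel" and u: "norm u = 1"
  shows "(\<integral>\<^sup>+\<theta>\<in>{0..<1}. indicator I (cis (2 * pi * \<theta>) * u) \<partial>lborel) = ennreal (arc_length I)"
proof -
  define s where "s = Arg2pi u / (2 * pi)"
  have s: "0 \<le> s" "s < 1" using Arg2pi[of u] by (auto simp: s_def)
  have us: "u = cis (2 * pi * s)"
    using Arg2pi_eq[of u] u by (simp add: s_def cis_conv_exp mult.commute)
  have "(\<integral>\<^sup>+\<theta>\<in>{0..<1}. indicator I (cis (2 * pi * \<theta>) * u) \<partial>lborel)
     = (\<integral>\<^sup>+\<theta>\<in>{0..<1}. indicator I (cis (2 * pi * (\<theta> + s))) \<partial>lborel)"
    by (simp add: us cis_mult algebra_simps)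
  also have "\<dots> = (\<integral>\<^sup>+\<theta>\<in>{0..<1}. indicator I (cis (2 * pi * \<theta>)) \<partial>lborel)"
    by (rule nn_integral_shift_periodic) (use s in \<open>auto simp: distrib_left cis_mult[symmetric]\<close>)
  also have "\<dots> = (\<integral>\<^sup>+\<theta>. indicator {\<theta>\<in>{0..<1}. cis (2 * pi * \<theta>) \<in> I} \<theta> \<partial>lborel)"
    by (intro nn_integral_cong) (auto simp: indicator_def)
  also have "\<dots> = emeasure lborel {\<theta>\<in>{0..<1}. cis (2 * pi * \<theta>) \<in> I}"
    by (rule nn_integral_indicator) measurable
  also have "\<dots> = ennreal (measure lborel {\<theta>\<in>{0..<1}. cis (2 * pi * \<theta>) \<in> I})"
  proof (rule emeasure_eq_ennreal_measure)
    have "emeasure lborel {\<theta>\<in>{0..<1}. cis (2 * pi * \<theta>) \<in> I} \<le> emeasure lborel {0..<1::real}"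
      by (rule emeasure_mono) auto
    then show "emeasure lborel {\<theta>\<in>{0..<1}. cis (2 * pi * \<theta>) \<in> I} \<noteq> top"
      by (auto simp: top_unique)
  qed
  also have "\<dots> = ennreal (arc_length I)"
    unfolding arc_length_def by (subst measure_completion) auto
  finally show ?thesis .
qed

text \<open>
  The angular half of polar coordinates, without a change of variables: the integral on the
  left is unchanged by rotations, so it equals its average over all of them. In that
  average the order of integration can be reversed, and then the inner integral is the
  constant \<open>arc_length I\<close>.
\<close>

lemma nn_integral_sector:
  fixes h :: "real \<Rightarrow> ennreal"
  assumes [measurable]: "h \<in> borel_measurable borel" "I \<in> sets borel"
  shows "(\<integral>\<^sup>+z. h (norm z) * indicator I (sgn z) \<partial>lborel)
      = ennreal (arc_length I) * (\<integral>\<^sup>+z. h (norm (z::complex)) \<partial>lborel)"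
proof -
  have rot: "(\<integral>\<^sup>+z. f (cis (2 * pi * \<theta>) * z) \<partial>lborel) = (\<integral>\<^sup>+z. f z \<partial>lborel)"
    if [measurable]: "f \<in> borel_measurable borel" for f :: "complex \<Rightarrow> ennreal" and \<theta>
    by (subst (2) lborel_rotate[symmetric, of "cis (2 * pi * \<theta>)"]) (simp_all add: nn_integral_distr)
  let ?L = "\<integral>\<^sup>+z. h (norm z) * indicator I (sgn z) \<partial>lborel"
  have "?L = (\<integral>\<^sup>+\<theta>\<in>{0..<1::real}. ?L \<partial>lborel)"
    by (subst nn_integral_cmult) auto
  also have "\<dots> = (\<integral>\<^sup>+\<theta>\<in>{0..<1::real}. (\<integral>\<^sup>+z. h (norm (cis (2 * pi * \<theta>) * z))
      * indicator I (sgn (cis (2 * pi * \<theta>) * z)) \<partial>lborel) \<partial>lborel)"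
    by (subst rot) auto
  also have "\<dots> = (\<integral>\<^sup>+\<theta>. (\<integral>\<^sup>+z. h (norm z) * (indicator I (cis (2 * pi * \<theta>) * sgn z)
      * indicator {0..<1::real} \<theta>) \<partial>lborel) \<partial>lborel)"
    by (subst nn_integral_multc[symmetric])
      (measurable, simp add: norm_mult sgn_mult mult_ac sgn_div_norm[of "cis _"])
  also have "\<dots> = (\<integral>\<^sup>+z. (\<integral>\<^sup>+\<theta>. h (norm z) * (indicator I (cis (2 * pi * \<theta>) * sgn z)
      * indicator {0..<1::real} \<theta>) \<partial>lborel) \<partial>lborel)"
    by (rule lborel_pair.Fubini') measurable
  also have "\<dots> = (\<integral>\<^sup>+z. h (norm z) * (\<integral>\<^sup>+\<theta>\<in>{0..<1}. indicator I (cis (2 * pi * \<theta>) * sgn z)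
      \<partial>lborel) \<partial>lborel)"
    by (subst nn_integral_cmult) auto
  also have "\<dots> = (\<integral>\<^sup>+z. h (norm (z::complex)) * ennreal (arc_length I) \<partial>lborel)"
  proof (rule nn_integral_cong_AE)
    show "AE z in lborel. h (norm z) * (\<integral>\<^sup>+\<theta>\<in>{0..<1}. indicator I (cis (2 * pi * \<theta>) * sgn z)
        \<partial>lborel)
        = h (norm (z::complex)) * ennreal (arc_length I)"
      using AE_lborel_singleton[of "0::complex"]
    proof eventually_elim
      case (elim z)
      then show ?case by (subst arc_length_average) (auto simp: norm_sgn)
    qed
  qed
  also have "\<dots> = (\<integral>\<^sup>+z. h (norm (z::complex)) \<partial>lborel) * ennreal (arc_length I)"
    by (rule nn_integral_multc) measurable
  finally show ?thesis by (simp add: mult.commute)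
qed

text \<open>
  The radial half of polar coordinates: the image of area under \<open>norm\<close> and the measure with
  density \<open>2 \<pi> r\<close> agree on all half-lines, by the area of a disc.
\<close>

lemma nn_integral_radial:
  fixes h :: "real \<Rightarrow> ennreal"
  assumes h [measurable]: "h \<in> borel_measurable borel"
  shows "(\<integral>\<^sup>+z\<in>ball 0 1. h (norm (z::complex)) \<partial>lborel)
      = ennreal pi * (\<integral>\<^sup>+r\<in>{0..<1}. ennreal (2 * r) * h r \<partial>lborel)"
proof -
  let ?M = "distr (density lborel (indicator (ball 0 1 :: complex set))) borel norm"
  let ?N = "density lborel (\<lambda>r. ennreal (2 * pi * r) * indicator {0..<1} r)"
  have Mx: "emeasure ?M {x<..} = ennreal (pi * (1 - (max 0 x)\<^sup>2)) " if "x < 1" for x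
  proof -
    have "emeasure ?M {x<..} = (\<integral>\<^sup>+z. indicator (ball 0 1 :: complex set) z
        * indicator (norm -` {x<..}) z \<partial>lborel)"
      by (subst emeasure_distr) (auto intro!: emeasure_density borel_measurable_indicator
          measurable_sets_borel[OF borel_measurable_norm] borel_measurable_norm)
    also have "\<dots> = (\<integral>\<^sup>+z. indicator (ball 0 1 - (if x < 0 then {} else cball 0 x)) z
        \<partial>(lborel::complex measure))"
      by (intro nn_integral_cong) (auto simp: indicator_def order.strict_trans2)
    also have "\<dots> = emeasure lborel (ball 0 1 - (if x < 0 then {} else cball 0 x) :: complex set)"
      by (rule nn_integral_indicator) auto
    also have "\<dots> = ennreal (pi * (1 - (max 0 x)\<^sup>2))"
    proof (cases "x < 0")
      case True
      then show ?thesis by (simp add: emeasure_ball unit_ball_vol_2)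
    next
      case False
      have "emeasure lborel (ball 0 1 - cball 0 x :: complex set)
          = emeasure lborel (ball 0 1 :: complex set) - emeasure lborel (cball 0 x :: complex set)"
        using that emeasure_lborel_cball_finite[of "0::complex" x] by (intro emeasure_Diff) auto
      also have "\<dots> = ennreal pi - ennreal (pi * x\<^sup>2)"
        using False by (simp add: emeasure_ball emeasure_cball unit_ball_vol_2)
      also have "\<dots> = ennreal (pi - pi * x\<^sup>2)"
        by (rule ennreal_minus) auto
      finally show ?thesis using False by (simp add: algebra_simps)
    qed
    finally show ?thesis .
  qed
  have Mx1: "emeasure ?M {x<..} = 0" if "x \<ge> 1" for x
  proof -
    have "emeasure ?M {x<..} = (\<integral>\<^sup>+z. indicator (ball 0 1 :: complex set) z
        * indicator (norm -` {x<..}) z \<partial>lborel)"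
      by (subst emeasure_distr) (auto intro!: emeasure_density borel_measurable_indicator
          measurable_sets_borel[OF borel_measurable_norm] borel_measurable_norm)
    also have "\<dots> = (\<integral>\<^sup>+z. 0 \<partial>(lborel :: complex measure))"
      using that by (intro nn_integral_cong) (auto simp: indicator_def)
    finally show ?thesis by simp
  qed
  have Nx: "emeasure ?N {x<..} = ennreal (pi * (1 - (max 0 x)\<^sup>2))" if "x < 1" for x
  proof -
    have "emeasure ?N {x<..} = (\<integral>\<^sup>+r. ennreal (2 * pi * r) * indicator {max 0 x..1} r \<partial>lborel)"
      by (subst emeasure_density)
        (auto intro!: nn_integral_cong_AE AE_I[where N="{0, 1, x}"] emeasure_lborel_countable
            simp: indicator_def of_bool_def max_def split: if_splits)
    also have "\<dots> = pi * 1\<^sup>2 - pi * (max 0 x)\<^sup>2"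
      using that by (intro nn_integral_FTC_Icc) (auto intro!: derivative_eq_intros)
    finally show ?thesis by (simp add: algebra_simps)
  qed
  have Nx1: "emeasure ?N {x<..} = 0" if "x \<ge> 1" for x
  proof -
    have "emeasure ?N {x<..} = (\<integral>\<^sup>+r. 0 \<partial>(lborel :: real measure))"
      using that by (subst emeasure_density)
        (auto intro!: nn_integral_cong simp del: nn_integral_const simp: indicator_def)
    then show ?thesis by simp
  qed
  have MN: "?M = ?N"
  proof (rule measure_eqI_lessThan)
    fix x :: real
    show "emeasure ?M {x<..} < \<infinity>" by (cases "x < 1") (simp_all add: Mx Mx1)
    show "emeasure ?M {x<..} = emeasure ?N {x<..}" by (cases "x < 1") (simp_all add: Mx Mx1 Nx Nx1)
  qed auto
  have "(\<integral>\<^sup>+z\<in>ball 0 1. h (norm (z::complex)) \<partial>lborel)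
      = (\<integral>\<^sup>+z. indicator (ball 0 1) z * h (norm (z::complex)) \<partial>lborel)"
    by (simp add: mult.commute)
  also have "\<dots> = (\<integral>\<^sup>+z. h (norm z) \<partial>density lborel (indicator (ball 0 1 :: complex set)))"
    by (rule nn_integral_density[symmetric]) (auto intro: borel_measurable_indicator)
  also have "\<dots> = (\<integral>\<^sup>+r. h r \<partial>?M)"
    by (rule nn_integral_distr[symmetric]) auto
  also have "\<dots> = (\<integral>\<^sup>+r. ennreal pi * (ennreal (2 * r) * h r * indicator {0..<1} r) \<partial>lborel)"
    unfolding MN by (subst nn_integral_density) (auto intro!: nn_integral_cong
        simp: indicator_def ennreal_mult' mult_ac)
  also have "\<dots> = ennreal pi * (\<integral>\<^sup>+r\<in>{0..<1}. ennreal (2 * r) * h r \<partial>lborel)"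
    by (rule nn_integral_cmult) auto
  finally show ?thesis .
qed

section \<open>Radial functions on the disc\<close>

lemma borel_measurable_indicator_ball [measurable]:
  "(\<lambda>z. indicator (ball a r) z :: ennreal) \<in> borel_measurable (borel :: 'a::metric_space measure)"
  by (rule borel_measurable_indicator) simp

lemma space_disc_area [simp]: "space disc_area = ball 0 1"
  by (simp add: disc_area_def space_scale_measure)

lemma sets_disc_area [simp]: "sets disc_area = sets (lebesgue_on (ball 0 1))"
  by (simp add: disc_area_def)

lemma nn_integral_disc_area:
  assumes "f \<in> borel_measurable disc_area"
  shows "(\<integral>\<^sup>+z. f z \<partial>disc_area) = ennreal (1 / pi) * (\<integral>\<^sup>+z\<in>ball 0 1. f z \<partial>lborel)"
proof -
  have f: "f \<in> borel_measurable (lebesgue_on (ball 0 1))"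
    using assms by (simp add: disc_area_def)
  show ?thesis
    unfolding disc_area_def nn_integral_scale_measure[OF f]
    by (subst nn_integral_restrict_space) (simp_all add: nn_integral_completion)
qed

lemma borel_measurable_disc_area:
  assumes "f \<in> borel_measurable borel"
  shows "f \<in> borel_measurable disc_area"
  unfolding measurable_cong_sets[OF sets_disc_area refl]
  using assms by (simp add: measurable_completion measurable_restrict_space1)

lemma AE_disc_area:
  "(AE z in disc_area. P z) \<longleftrightarrow> (AE z in lborel. z \<in> ball 0 1 \<longrightarrow> P z)"
proof -
  have "(AE z in disc_area. P z) \<longleftrightarrow> (AE z in lebesgue_on (ball 0 1). P z)"
    unfolding disc_area_def eventually_ae_filter null_sets_def
    by (simp add: space_scale_measure)
  also have "\<dots> \<longleftrightarrow> (AE z in lborel. z \<in> ball 0 1 \<longrightarrow> P z)"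
    by (subst AE_restrict_space_iff) (simp_all add: AE_completion_iff)
  finally show ?thesis .
qed

lemma borel_measurable_lebesgue_cong_AE:
  fixes f g :: "'a::euclidean_space \<Rightarrow> ennreal"
  assumes g: "g \<in> borel_measurable borel" and eq: "AE z in lborel. g z = f z"
  shows "f \<in> borel_measurable lebesgue"
proof (rule measurableI)
  fix A :: "ennreal set" assume A: "A \<in> sets borel"
  have "AE z in lebesgue. (z \<in> g -` A) = (z \<in> f -` A)"
    using eq unfolding AE_completion_iff by eventually_elim auto
  moreover have "g -` A \<in> sets lebesgue"
    using measurable_sets_borel[OF g A] by (intro sets_completionI_sets) simp
  ultimately have "f -` A \<in> sets lebesgue"
    by (rule completion.in_sets_AE) simp
  then show "f -` A \<inter> space lebesgue \<in> sets lebesgue" by simp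
qed simp

lemma measurable_disc_area_cong_AE:
  fixes f g :: "complex \<Rightarrow> ennreal"
  assumes g: "g \<in> borel_measurable borel" and eq: "AE z in disc_area. f z = g z"
  shows "f \<in> borel_measurable disc_area"
proof -
  have "AE z in lborel. g z * indicator (ball 0 1) z = f z * indicator (ball 0 1) z"
    using eq unfolding AE_disc_area by eventually_elim (auto simp: indicator_def)
  moreover have "(\<lambda>z. g z * indicator (ball 0 1) z) \<in> borel_measurable borel"
    by (intro borel_measurable_times_ennreal borel_measurable_indicator g) auto
  ultimately have "(\<lambda>z. f z * indicator (ball 0 1) z) \<in> borel_measurable lebesgue"
    by (rule borel_measurable_lebesgue_cong_AE[rotated])
  then show ?thesis
    unfolding measurable_cong_sets[OF sets_disc_area refl]
    by (rule borel_measurable_restrict_space_iff_ennreal[THEN iffD2, rotated]) simp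
qed

text \<open>
  Weights are Lebesgue measurable only, so null sets of radii must be seen to produce null sets in
  the disc.
\<close>

lemma radial_AE_disc:
  assumes "AE r in lborel. P r"
  shows "AE z in disc_area. P (norm z)"
proof -
  obtain N where N: "{r. \<not> P r} \<subseteq> N" "N \<in> sets borel" "emeasure lborel N = 0"
    using assms by (auto simp: eventually_ae_filter null_sets_def)
  have [measurable]: "N \<in> sets borel" by fact
  have "(\<integral>\<^sup>+z\<in>ball 0 1. indicator N (norm (z::complex)) \<partial>lborel)
      = ennreal pi * (\<integral>\<^sup>+r\<in>{0..<1}. ennreal (2 * r) * indicator N r \<partial>lborel)"
    by (rule nn_integral_radial) measurable
  also have "(\<integral>\<^sup>+r\<in>{0..<1}. ennreal (2 * r) * indicator N r \<partial>lborel)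
      = (\<integral>\<^sup>+r. 0 \<partial>(lborel :: real measure))"
    using N by (intro nn_integral_cong_AE AE_I[where N=N]) (auto simp: indicator_def)
  finally have "(\<integral>\<^sup>+z\<in>ball 0 1. indicator N (norm (z::complex)) \<partial>lborel) = 0"
    by (simp only: nn_integral_const mult_zero_left mult_zero_right)
  then have "AE z in lborel. indicator N (norm (z::complex)) * indicator (ball 0 1) z
      = (0::ennreal)"
    by (rule nn_integral_0_iff_AE[THEN iffD1, rotated]) measurable
  then show ?thesis
    unfolding AE_disc_area by eventually_elim (use N in \<open>auto simp: indicator_def\<close>)
qed

lemma radial_measurable:
  fixes h :: "real \<Rightarrow> ennreal"
  assumes "h \<in> borel_measurable lebesgue"
  shows "(\<lambda>z. h (norm z)) \<in> borel_measurable disc_area"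
proof -
  obtain h' where "h' \<in> borel_measurable lborel" and eq: "AE r in lborel. h r = h' r"
    using completion_ex_borel_measurable[OF assms] by blast
  then have [measurable]: "h' \<in> borel_measurable borel" by simp
  show ?thesis
    by (rule measurable_disc_area_cong_AE[of "\<lambda>z. h' (norm z)"]) (use radial_AE_disc[OF eq] in auto)
qed

lemma disc_polar:
  fixes h :: "real \<Rightarrow> ennreal"
  assumes h: "h \<in> borel_measurable lebesgue" and [measurable]: "I \<in> sets borel"
  shows "(\<integral>\<^sup>+z. h (norm z) * indicator I (sgn z) \<partial>disc_area) =
    ennreal (arc_length I) * (\<integral>\<^sup>+r\<in>{0..<1}. ennreal (2 * r) * h r \<partial>lebesgue)"
proof -
  obtain h' where "h' \<in> borel_measurable lborel" and eq: "AE r in lborel. h r = h' r"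
    using completion_ex_borel_measurable[OF h] by blast
  then have [measurable]: "h' \<in> borel_measurable borel" by simp
  have "(\<integral>\<^sup>+z. h (norm z) * indicator I (sgn z) \<partial>disc_area)
      = (\<integral>\<^sup>+z. h' (norm z) * indicator I (sgn z) \<partial>disc_area)"
    using radial_AE_disc[OF eq] by (intro nn_integral_cong_AE) auto
  also have "\<dots> = ennreal (1 / pi) * (\<integral>\<^sup>+z\<in>ball 0 1. (h' (norm z) * indicator I (sgn z)) \<partial>lborel)"
    by (rule nn_integral_disc_area) (intro borel_measurable_disc_area, measurable)
  also have "(\<integral>\<^sup>+z\<in>ball 0 1. (h' (norm z) * indicator I (sgn z)) \<partial>lborel)
     = (\<integral>\<^sup>+z. (h' (norm z) * indicator {..<1} (norm z)) * indicator I (sgn z) \<partial>lborel)"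
    by (intro nn_integral_cong) (auto simp: indicator_def)
  also have "\<dots> = ennreal (arc_length I) * (\<integral>\<^sup>+z. h' (norm z)
      * indicator {..<1} (norm (z::complex)) \<partial>lborel)"
    by (rule nn_integral_sector) measurable
  also have "(\<integral>\<^sup>+z. h' (norm z) * indicator {..<1} (norm (z::complex)) \<partial>lborel)
      = (\<integral>\<^sup>+z\<in>ball 0 1. h' (norm (z::complex)) \<partial>lborel)"
    by (intro nn_integral_cong) (auto simp: indicator_def)
  also have "\<dots> = ennreal pi * (\<integral>\<^sup>+r\<in>{0..<1}. ennreal (2 * r) * h' r \<partial>lborel)"
    by (rule nn_integral_radial) measurable
  also have "(\<integral>\<^sup>+r\<in>{0..<1}. ennreal (2 * r) * h' r \<partial>lborel)
      = (\<integral>\<^sup>+r\<in>{0..<1}. ennreal (2 * r) * h r \<partial>lebesgue)"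
    unfolding nn_integral_completion using eq by (intro nn_integral_cong_AE) auto
  also have "ennreal (1 / pi) * (ennreal (arc_length I) * (ennreal pi * (\<integral>\<^sup>+r\<in>{0..<1}.
      ennreal (2 * r) * h r \<partial>lebesgue)))
     = ennreal (1 / pi * pi) * (ennreal (arc_length I) * (\<integral>\<^sup>+r\<in>{0..<1}. ennreal (2 * r) * h r \<partial>lebesgue))"
    by (subst ennreal_mult) (auto simp: mult_ac)
  finally show ?thesis by simp
qed

text \<open>
  The interval may wrap around the circle several times, so injectivity is not available. An
  interval is a countable union of compact ones, and these have compact images.
\<close>

lemma circle_arc_borel: "circle_arc I \<Longrightarrow> I \<in> sets borel"
  unfolding circle_arc_def
proof (elim exE conjE)
  fix J :: "real set" assume J: "is_interval J" and I: "I = (\<lambda>\<theta>. cis (2 * pi * \<theta>)) ` J"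
  (* The extrema have to be added: an end point of J that belongs to J need not be rational. *)
  define E where "E = J \<inter> (\<rat> \<union> {Inf J, Sup J})"
  have E: "countable E" "E \<subseteq> J"
    by (auto simp: E_def countable_rat intro!: countable_Int2)
  have lower: "\<exists>a\<in>E. a \<le> x" if "x \<in> J" for x
  proof (cases "\<exists>y\<in>J. y < x")
    case True
    then obtain y q where "y \<in> J" "y < q" "q < x" "q \<in> \<rat>"
      using Rats_dense_in_real by blast
    then have "q \<in> J"
      using J that unfolding is_interval_1 by (meson less_imp_le)
    with \<open>q \<in> \<rat>\<close> have "q \<in> E" by (simp add: E_def)
    with \<open>q < x\<close> show ?thesis by (auto intro: less_imp_le)
  next
    case False
    then have "Inf J = x" using that by (intro cInf_eq_minimum) (auto simp: not_less)
    with that show ?thesis by (auto simp: E_def)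
  qed
  have upper: "\<exists>b\<in>E. x \<le> b" if "x \<in> J" for x
  proof (cases "\<exists>y\<in>J. x < y")
    case True
    then obtain y q where "y \<in> J" "x < q" "q < y" "q \<in> \<rat>"
      using Rats_dense_in_real by blast
    then have "q \<in> J"
      using J that unfolding is_interval_1 by (meson less_imp_le)
    with \<open>q \<in> \<rat>\<close> have "q \<in> E" by (simp add: E_def)
    with \<open>x < q\<close> show ?thesis by (auto intro: less_imp_le)
  next
    case False
    then have "Sup J = x" using that by (intro cSup_eq_maximum) (auto simp: not_less)
    with that show ?thesis by (auto simp: E_def)
  qed
  have "x \<in> J" if "a \<in> E" "b \<in> E" "a \<le> x" "x \<le> b" for a b x
    using J E(2) that unfolding is_interval_1 by blast
  then have "J = (\<Union>a\<in>E. \<Union>b\<in>E. {a..b})"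
    using lower upper by fastforce
  then have "I = (\<Union>a\<in>E. \<Union>b\<in>E. (\<lambda>\<theta>. cis (2 * pi * \<theta>)) ` {a..b})"
    unfolding I by blast
  moreover have "(\<lambda>\<theta>. cis (2 * pi * \<theta>)) ` {a..b} \<in> sets borel" for a b :: real
    by (intro borel_compact compact_continuous_image continuous_intros) auto
  ultimately show ?thesis
    using E(1) by (auto intro!: sets.countable_UN')
qed

section \<open>Carleson boxes of dyadic arcs\<close>

lemma mem_carleson_box: "z \<in> carleson_box I \<longleftrightarrow> norm z < 1 \<and> sgn z \<in> I \<and> 1 - arc_length I \<le> norm z"
  by (auto simp: carleson_box_def sgn_eq)

lemma carleson_box_borel [measurable]:
  assumes [measurable]: "I \<in> sets borel"
  shows "carleson_box I \<in> sets borel"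
proof -
  have "carleson_box I = (sgn -` I \<inter> space borel) \<inter> {z. norm z < 1} \<inter> {z. 1 - arc_length I
      \<le> norm z}"
    by (auto simp: mem_carleson_box)
  also have "\<dots> \<in> sets borel"
    by (intro sets.Int measurable_sets[OF borel_measurable_sgn_complex]) auto
  finally show ?thesis .
qed

lemma borel_sets_disc_area: "A \<in> sets borel \<Longrightarrow> A \<subseteq> ball 0 1 \<Longrightarrow> A \<in> sets disc_area"
  by (auto simp: sets_restrict_space_iff)

lemma nn_integral_2r:
  assumes "0 \<le> a" "a \<le> 1"
  shows "(\<integral>\<^sup>+r\<in>{a..<1}. ennreal (2 * r) \<partial>lebesgue) = ennreal (1 - a\<^sup>2)"
proof -
  have "(\<integral>\<^sup>+r\<in>{a..<1}. ennreal (2 * r) \<partial>lebesgue)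
      = (\<integral>\<^sup>+r. ennreal (2 * r) * indicator {a..1} r \<partial>lborel)"
    unfolding nn_integral_completion
    by (intro nn_integral_cong_AE AE_I[where N="{1}"]) (auto
        simp: indicator_def of_bool_def split: if_splits)
  also have "\<dots> = 1\<^sup>2 - a\<^sup>2"
    using assms by (intro nn_integral_FTC_Icc) (auto intro!: derivative_eq_intros)
  finally show ?thesis by simp
qed

text \<open>
  The length of an arc of generation \<open>k\<close> times the normalized area of the annulus
  \<open>1 - 1 / 2 ^ k \<le> norm z < 1\<close>.
\<close>

definition box_area :: "nat \<Rightarrow> real" where
  "box_area k = 1 / 2 ^ k * (1 - (1 - 1 / 2 ^ k)\<^sup>2)"

lemma box_area_bounds: "(1 / 2 ^ k)\<^sup>2 \<le> box_area k" "box_area k \<le> 2 * (1 / 2 ^ k)\<^sup>2"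
proof -
  define d :: real where "d = 1 / 2 ^ k"
  have d: "0 < d" "d \<le> 1" by (auto simp: d_def)
  have eq: "box_area k = d\<^sup>2 * (2 - d)"
    by (simp add: box_area_def d_def[symmetric] power2_eq_square algebra_simps)
  show "(1 / 2 ^ k)\<^sup>2 \<le> box_area k" "box_area k \<le> 2 * (1 / 2 ^ k)\<^sup>2"
    unfolding eq d_def[symmetric] using d mult_left_mono[of 1 "2 - d" "d\<^sup>2"] by auto
qed

lemma box_area_pos: "0 < box_area k"
  by (rule less_le_trans[OF _ box_area_bounds(1)]) simp

context
  fixes \<D> :: "nat \<Rightarrow> complex set set"
  assumes dyadic: "dyadic_system \<D>"
begin

lemma dyadic_finite: "finite (\<D> k)"
  using dyadic by (metis dyadic_system_def card.infinite power_not_zero zero_neq_numeral)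

lemma dyadic_length: "I \<in> \<D> k \<Longrightarrow> arc_length I = 1 / 2 ^ k"
  using dyadic by (auto simp: dyadic_system_def)

lemma dyadic_borel: "I \<in> \<D> k \<Longrightarrow> I \<in> sets borel"
  using dyadic by (auto simp: dyadic_system_def intro: circle_arc_borel)

lemma dyadic_nonempty: "I \<in> \<D> k \<Longrightarrow> I \<noteq> {}"
  using dyadic_length[of I k] by (auto simp: arc_length_def)

lemma dyadic_cover: "x \<in> sphere 0 1 \<Longrightarrow> \<exists>I\<in>\<D> k. x \<in> I"
  using dyadic unfolding dyadic_system_def by blast

lemma dyadic_sphere: "I \<in> \<D> k \<Longrightarrow> I \<subseteq> sphere 0 1"
  using dyadic unfolding dyadic_system_def by blast

lemma dyadic_same_level: "I \<in> \<D> k \<Longrightarrow> J \<in> \<D> k \<Longrightarrow> I \<inter> J \<noteq> {} \<Longrightarrow> I = J"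
  using dyadic unfolding dyadic_system_def disjoint_def by blast

text \<open>
  A dyadic system prescribes only how an arc splits. Conversely every arc of generation
  \<open>k + 1\<close> lies in one of generation \<open>k\<close>: one of its points is covered by an arc of generation \<open>k\<close>,
  and disjointness identifies the arc with one of the two halves of that one.
\<close>

lemma dyadic_ancestor:
  assumes "J \<in> \<D> (k + n)"
  shows "\<exists>I\<in>\<D> k. J \<subseteq> I"
  using assms
proof (induction n arbitrary: J)
  case 0
  then show ?case by auto
next
  case (Suc n)
  obtain x where x: "x \<in> J" using dyadic_nonempty[OF Suc.prems] by auto
  then have "x \<in> sphere 0 1" using dyadic_sphere[OF Suc.prems] by blast
  then obtain P where P: "P \<in> \<D> (k + n)" "x \<in> P" using dyadic_cover by blast
  then obtain J1 J2 where J12: "J1 \<in> \<D> (Suc (k + n))" "J2 \<in> \<D> (Suc (k + n))" "P = J1 \<union> J2"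
    using dyadic unfolding dyadic_system_def by blast
  have J: "J \<in> \<D> (Suc (k + n))" using Suc.prems by simp
  have "J = J1 \<or> J = J2"
    using dyadic_same_level[OF J J12(1)] dyadic_same_level[OF J J12(2)] x P(2) J12(3) by blast
  then have "J \<subseteq> P" using J12(3) by blast
  with Suc.IH[OF P(1)] show ?case by blast
qed

lemma dyadic_nested:
  assumes "I \<in> \<D> k" "J \<in> \<D> l" "k \<le> l" "I \<inter> J \<noteq> {}"
  shows "J \<subseteq> I"
proof -
  obtain P where P: "P \<in> \<D> k" "J \<subseteq> P"
    using dyadic_ancestor[of J k "l - k"] assms by auto
  with assms have "P = I" by (intro dyadic_same_level[of _ k]) auto
  with P show ?thesis by simp
qed

lemma box_sets: "I \<in> \<D> k \<Longrightarrow> carleson_box I \<in> sets disc_area"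
  by (intro borel_sets_disc_area carleson_box_borel dyadic_borel) (auto simp: mem_carleson_box)

lemma radial_integral_box:
  fixes h :: "real \<Rightarrow> ennreal"
  assumes h: "h \<in> borel_measurable lebesgue" and I: "I \<in> \<D> k"
  shows "(\<integral>\<^sup>+z\<in>carleson_box I. h (norm z) \<partial>disc_area)
    = ennreal (1 / 2 ^ k) * (\<integral>\<^sup>+r\<in>{1 - 1 / 2 ^ k..<1}. ennreal (2 * r) * h r \<partial>lebesgue)"
proof -
  define h1 where "h1 = (\<lambda>r. h r * indicator {1 - 1 / 2 ^ k..<1} r)"
  have h1: "h1 \<in> borel_measurable lebesgue"
    unfolding h1_def by (intro borel_measurable_times_ennreal h borel_measurable_indicator) auto
  have "(\<integral>\<^sup>+z\<in>carleson_box I. h (norm z) \<partial>disc_area)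
      = (\<integral>\<^sup>+z. h1 (norm z) * indicator I (sgn z) \<partial>disc_area)"
    by (intro nn_integral_cong) (auto
        simp: h1_def indicator_def mem_carleson_box dyadic_length[OF I])
  also have "\<dots> = ennreal (arc_length I) * (\<integral>\<^sup>+r\<in>{0..<1}. ennreal (2 * r) * h1 r \<partial>lebesgue)"
    by (rule disc_polar[OF h1 dyadic_borel[OF I]])
  also have "(\<integral>\<^sup>+r\<in>{0..<1}. ennreal (2 * r) * h1 r \<partial>lebesgue)
      = (\<integral>\<^sup>+r\<in>{1 - 1 / 2 ^ k..<1}. ennreal (2 * r) * h r \<partial>lebesgue)"
  proof (intro nn_integral_cong)
    fix r :: real
    have "(0::real) \<le> 1 - 1 / 2 ^ k" by simp
    then have "0 \<le> r" if "1 - 1 / 2 ^ k \<le> r" using that by (rule order_trans)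
    then show "ennreal (2 * r) * h1 r * indicator {0..<1} r
        = ennreal (2 * r) * h r * indicator {1 - 1 / 2 ^ k..<1} r"
      by (auto simp: h1_def indicator_def)
  qed
  finally show ?thesis by (simp add: dyadic_length[OF I])
qed

lemma emeasure_box: "I \<in> \<D> k \<Longrightarrow> emeasure disc_area (carleson_box I) = ennreal (box_area k)"
proof -
  assume I: "I \<in> \<D> k"
  have "emeasure disc_area (carleson_box I) = (\<integral>\<^sup>+z\<in>carleson_box I. 1 \<partial>disc_area)"
    using box_sets[OF I] by simp
  also have "\<dots> = ennreal (1 / 2 ^ k) * (\<integral>\<^sup>+r\<in>{1 - 1 / 2 ^ k..<1}. ennreal (2 * r) \<partial>lebesgue)"
    using radial_integral_box[OF _ I, of "\<lambda>_. 1"] by simp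
  also have "\<dots> = ennreal (1 / 2 ^ k) * ennreal (1 - (1 - 1 / 2 ^ k)\<^sup>2)"
    by (subst nn_integral_2r) auto
  also have "\<dots> = ennreal (box_area k)"
    by (simp add: box_area_def ennreal_mult'[symmetric])
  finally show ?thesis .
qed

lemma measure_box: "I \<in> \<D> k \<Longrightarrow> measure disc_area (carleson_box I) = box_area k"
proof -
  have "(1 - 1 / 2 ^ k)\<^sup>2 \<le> (1::real)" by (intro power_le_one) auto
  then have "0 \<le> box_area k" by (simp add: box_area_def)
  then show "I \<in> \<D> k \<Longrightarrow> measure disc_area (carleson_box I) = box_area k"
    by (simp add: measure_def emeasure_box)
qed

lemma box_mono:
  assumes "I \<in> \<D> k" "J \<in> \<D> l" "I \<subseteq> J"
  shows "carleson_box I \<subseteq> carleson_box J"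
proof -
  have "l \<le> k"
  proof (rule ccontr)
    assume "\<not> l \<le> k"
    then have "J \<subseteq> I"
        using dyadic_nested[OF assms(1,2)] assms(3) dyadic_nonempty[OF assms(1)] by auto
    with assms have "I = J" by auto
    then have "(1::real) / 2 ^ k = 1 / 2 ^ l"
        using dyadic_length[OF assms(1)] dyadic_length[OF assms(2)] by simp
    with \<open>\<not> l \<le> k\<close> show False by simp
  qed
  then have "(1::real) / 2 ^ k \<le> 1 / 2 ^ l" by (simp add: field_simps)
  then show ?thesis
    using assms(3) by (auto
        simp: mem_carleson_box dyadic_length[OF assms(1)] dyadic_length[OF assms(2)])
qed

lemma sum_length_disjoint:
  assumes "finite F" "F \<subseteq> (\<Union>k. \<D> k)" "disjoint F"
  shows "(\<Sum>I\<in>F. arc_length I) \<le> 1"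
proof -
  let ?P = "\<lambda>I. {\<theta>\<in>{0..<1}. cis (2 * pi * \<theta>) \<in> I}"
  have P: "?P I \<in> lmeasurable" if "I \<in> F" for I
  proof (rule bounded_set_imp_lmeasurable)
    have [measurable]: "I \<in> sets borel" using that assms dyadic_borel by blast
    have "?P I \<in> sets borel" by measurable
    then show "?P I \<in> sets lebesgue" by simp
    show "bounded (?P I)" by (rule bounded_subset[of "{0..1}"]) auto
  qed
  have unit: "{0..<1::real} \<in> lmeasurable"
    by (rule bounded_set_imp_lmeasurable) (auto intro: bounded_subset[of "{0..1}"])
  have "(\<Sum>I\<in>F. arc_length I) = measure lebesgue (\<Union>I\<in>F. ?P I)"
    unfolding arc_length_def
    by (rule measure_UNION'[symmetric]) (use assms P in \<open>auto
        simp: disjoint_def disjnt_def pairwise_def\<close>)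
  also have "\<dots> \<le> measure lebesgue {0..<1::real}"
    using P assms unit by (intro measure_mono_fmeasurable) auto
  finally show ?thesis by simp
qed

text \<open>
  The covering argument. Among the arcs of \<open>S\<close> of generation at most \<open>n\<close>, the maximal ones are
  finitely many, pairwise disjoint because dyadic arcs are nested, and their boxes cover the
  boxes of the others. So a bound for finite disjoint families passes to the whole union.
\<close>

lemma emeasure_Union_boxes_le:
  assumes S: "S \<subseteq> (\<Union>k. \<D> k)"
    and K: "\<And>F. finite F \<Longrightarrow> F \<subseteq> S \<Longrightarrow> disjoint F \<Longrightarrow> c * (\<Sum>I\<in>F. emeasure disc_area (carleson_box I)) \<le> K"
  shows "c * emeasure disc_area (\<Union>I\<in>S. carleson_box I) \<le> K"
proof -
  define T where "T n = S \<inter> (\<Union>k\<le>n. \<D> k)" for n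
  have fin: "finite (T n)" for n by (auto simp: T_def dyadic_finite)
  have TS: "T n \<subseteq> S" for n by (auto simp: T_def)
  have sets: "carleson_box I \<in> sets disc_area" if "I \<in> S" for I
    using that S box_sets by blast
  have "S = (\<Union>n. T n)" using S unfolding T_def by blast
  then have Un: "(\<Union>I\<in>S. carleson_box I) = (\<Union>n. \<Union>I\<in>T n. carleson_box I)" by blast
  have "T n \<subseteq> T (Suc n)" for n unfolding T_def by (auto simp: atMost_Suc)
  then have inc: "incseq (\<lambda>n. \<Union>I\<in>T n. carleson_box I)"
    by (intro incseq_SucI UN_mono) auto
  have "c * emeasure disc_area (\<Union>I\<in>T n. carleson_box I) \<le> K" for n
  proof -
    define F where "F = {I \<in> T n. \<forall>J\<in>T n. I \<subseteq> J \<longrightarrow> I = J}"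
    have F: "finite F" "F \<subseteq> S" using fin[of n] TS[of n] by (auto simp: F_def)
    have "disjoint F"
    proof (rule disjointI)
      fix I J assume IJ: "I \<in> F" "J \<in> F" "I \<noteq> J"
      then obtain k l where kl: "I \<in> \<D> k" "J \<in> \<D> l" by (auto simp: F_def T_def)
      show "I \<inter> J = {}"
      proof (rule ccontr)
        assume "I \<inter> J \<noteq> {}"
        then have "J \<subseteq> I \<or> I \<subseteq> J"
          using dyadic_nested[OF kl] dyadic_nested[OF kl(2,1)] by (metis Int_commute nle_le)
        then show False using IJ by (auto simp: F_def)
      qed
    qed
    have "(\<Union>I\<in>T n. carleson_box I) \<subseteq> (\<Union>I\<in>F. carleson_box I)"
    proof (rule UN_least)
      fix I assume I: "I \<in> T n"
      obtain J where J: "J \<in> T n" "I \<subseteq> J" "\<forall>L\<in>T n. J \<subseteq> L \<longrightarrow> J = L"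
        using finite_has_maximal2[OF fin I] by blast
      then have "J \<in> F" by (simp add: F_def)
      moreover obtain k l where "I \<in> \<D> k" "J \<in> \<D> l" using I J(1) by (auto simp: T_def)
      then have "carleson_box I \<subseteq> carleson_box J" using J(2) by (rule box_mono)
      ultimately show "carleson_box I \<subseteq> (\<Union>I\<in>F. carleson_box I)" by blast
    qed
    then have "emeasure disc_area (\<Union>I\<in>T n. carleson_box I)
        \<le> emeasure disc_area (\<Union>I\<in>F. carleson_box I)"
      by (rule emeasure_mono) (intro sets.finite_UN sets F(1), use F(2) in blast)
    also have "\<dots> \<le> (\<Sum>I\<in>F. emeasure disc_area (carleson_box I))"
      by (rule emeasure_subadditive_finite) (use F sets in auto)
    finally have "c * emeasure disc_area (\<Union>I\<in>T n. carleson_box I)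
        \<le> c * (\<Sum>I\<in>F. emeasure disc_area (carleson_box I))"
      by (rule mult_left_mono) simp
    also have "\<dots> \<le> K" by (rule K[OF F \<open>disjoint F\<close>])
    finally show ?thesis .
  qed
  moreover have "emeasure disc_area (\<Union>I\<in>S. carleson_box I)
      = (SUP n. emeasure disc_area (\<Union>I\<in>T n. carleson_box I))"
    unfolding Un
        by (rule SUP_emeasure_incseq[symmetric, OF _ inc]) (use fin TS sets in \<open>blast intro: sets.finite_UN\<close>)
  ultimately show ?thesis
    by (simp add: SUP_mult_left_ennreal SUP_least)
qed

lemma maximal_superlevel:
  "{z \<in> ball 0 1. dyadic_maximal \<D> t f z > ennreal s} =
    (\<Union>I\<in>{I \<in> (\<Union>k. \<D> k). ennreal s < ennreal (1 / measure disc_area (carleson_box I) powr t) *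
        (\<integral>\<^sup>+w\<in>carleson_box I. ennreal (norm (f w)) \<partial>disc_area)}. carleson_box I)"
  unfolding dyadic_maximal_def less_SUP_iff by (auto simp: mem_carleson_box)

end

section \<open>Sufficiency\<close>

text \<open>
  Young's inequality, with a free parameter \<open>s\<close> and with the weight \<open>v\<close> shared between the two
  factors. It replaces Hoelder's inequality below: \<open>s\<close> is chosen only after integration and
  summation. At \<open>v = 0\<close> the last term is infinite.
\<close>

lemma weighted_Young:
  fixes a p q s v w :: real
  assumes pq: "p > 1" "q > 1" "1 / p + 1 / q = 1" and pos: "s > 0" "w > 0" "a \<ge> 0" "v \<ge> 0"
  shows "ennreal (a * w) \<le> ennreal (s powr p / p) * ennreal (a powr p * v) +
    ennreal (w powr q * s powr (- q) / q) * (1 / ennreal (v powr (q / p)))"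
proof (cases "v = 0")
  case True
  then have "1 / ennreal (v powr (q / p)) = top" by (simp add: ennreal_divide_zero)
  then show ?thesis using pq pos by (simp add: ennreal_mult_top)
next
  case False
  then have v: "v > 0" using pos by simp
  define x y where "x = s * a * v powr (1 / p)" and "y = w * v powr (- 1 / p) / s"
  have "a * w = x * y"
    using pos v by (simp add: x_def y_def powr_minus field_simps)
  also have "\<dots> \<le> x powr p / p + y powr q / q"
    by (rule Youngs_inequality) (use pq pos in \<open>auto simp: x_def y_def\<close>)
  also have "x powr p = s powr p * (a powr p * v)"
    using pos pq v by (simp add: x_def powr_mult powr_powr)
  also have "y powr q = w powr q * s powr (- q) * (1 / v powr (q / p))"
    using pos pq v by (simp add: y_def powr_mult powr_divide powr_powr powr_minus field_simps)
  finally have "a * w \<le> s powr p / p * (a powr p * v) + w powr q * s powr (- q) / q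
      * (1 / v powr (q / p))"
    by (simp add: field_simps)
  then have "ennreal (a * w) \<le> ennreal (s powr p / p * (a powr p * v) + w powr q
      * s powr (- q) / q * (1 / v powr (q / p)))"
    by (rule ennreal_leI)
  also have "\<dots> = ennreal (s powr p / p) * ennreal (a powr p * v) +
    ennreal (w powr q * s powr (- q) / q) * (1 / ennreal (v powr (q / p)))"
  proof -
    have e: "1 / ennreal (v powr (q / p)) = ennreal (1 / v powr (q / p))"
      using v by (simp add: divide_ennreal flip: ennreal_1)
    have split: "ennreal (A * B + C * D) = ennreal A * ennreal B + ennreal C * ennreal D"
      if "A \<ge> 0" "B \<ge> 0" "C \<ge> 0" "D \<ge> 0" for A B C D
      using that by (simp add: ennreal_mult)
    show ?thesis
      unfolding e by (rule split) (use pq pos v in auto)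
  qed
  finally show ?thesis .
qed

text \<open>
  The tail is covered by the dyadic annuli, whose bounds form a geometric series.
\<close>

lemma tail_integral_le:
  fixes h :: "real \<Rightarrow> ennreal"
  assumes h: "h \<in> borel_measurable lebesgue" and a: "a \<ge> 0"
    and ann: "\<And>k. (\<integral>\<^sup>+r\<in>{1 - 1 / 2 ^ k..1 - 1 / 2 ^ (k + 1)}. h r \<partial>lebesgue) \<le> ennreal (a / 2 ^ k)"
  shows "(\<integral>\<^sup>+r\<in>{1 - 1 / 2 ^ k..<1}. h r \<partial>lebesgue) \<le> ennreal (2 * a / 2 ^ k)"
proof -
  let ?A = "\<lambda>k::nat. {1 - 1 / 2 ^ k..1 - 1 / 2 ^ (k + 1)} :: real set"
  have cover: "\<exists>j. r \<in> ?A (k + j)" if r: "1 - 1 / 2 ^ k \<le> r" "r < 1" for r :: real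
  proof -
    obtain n where n: "(1/2) ^ n < 1 - r" using real_arch_pow_inv[of "1 - r" "1/2"] r by auto
    (* The annulus is the first one whose outer radius is at least r, but not one before the k-th. *)
    define m where "m = (LEAST m. r \<le> 1 - 1 / 2 ^ (m + 1))"
    have "(1/2) ^ (n + 1) \<le> (1/2::real) ^ n" by (rule power_decreasing) auto
    then have ex: "r \<le> 1 - 1 / 2 ^ (n + 1)" using n by (simp add: power_divide)
    have m: "r \<le> 1 - 1 / 2 ^ (m + 1)" unfolding m_def by (rule LeastI[of _ n]) (rule ex)
    have lower: "1 - 1 / 2 ^ m \<le> r \<or> m \<le> k"
    proof (cases m)
      case (Suc m')
      then have "\<not> r \<le> 1 - 1 / 2 ^ (m' + 1)"
        using not_less_Least[of m' "\<lambda>m. r \<le> 1 - 1 / 2 ^ (m + 1)", folded m_def] by simp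
      then show ?thesis using Suc by simp
    qed simp
    show ?thesis
    proof (cases "m \<le> k")
      case True
      then have "(1/2) ^ (k + 1) \<le> (1/2::real) ^ (m + 1)" by (intro power_decreasing) auto
      then have "r \<le> 1 - 1 / 2 ^ (k + 1)" using m by (simp add: power_divide)
      then show ?thesis using r by (intro exI[of _ 0]) simp
    next
      case False
      then show ?thesis using m lower by (intro exI[of _ "m - k"]) auto
    qed
  qed
  have "(\<integral>\<^sup>+r\<in>{1 - 1 / 2 ^ k..<1}. h r \<partial>lebesgue)
      \<le> (\<integral>\<^sup>+r. (\<Sum>j. h r * indicator (?A (k + j)) r) \<partial>lebesgue)"
  proof (rule nn_integral_mono)
    fix r :: real
    show "h r * indicator {1 - 1 / 2 ^ k..<1} r \<le> (\<Sum>j. h r * indicator (?A (k + j)) r)"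
    proof (cases "r \<in> {1 - 1 / 2 ^ k..<1}")
      case True
      then obtain j where j: "r \<in> ?A (k + j)" using cover[of r] by auto
      have "h r * indicator {1 - 1 / 2 ^ k..<1} r \<le> (\<Sum>i\<in>{j}. h r * indicator (?A (k + i)) r)"
        using True j by (simp only: sum.insert sum.empty indicator_simps finite.intros) simp
      also have "\<dots> \<le> (\<Sum>j. h r * indicator (?A (k + j)) r)"
        by (rule sum_le_suminf) auto
      finally show ?thesis .
    qed simp
  qed
  also have "\<dots> = (\<Sum>j. \<integral>\<^sup>+r\<in>?A (k + j). h r \<partial>lebesgue)"
    by (rule nn_integral_suminf) (intro borel_measurable_times_ennreal h borel_measurable_indicator, simp)
  also have "\<dots> \<le> (\<Sum>j. ennreal (a / 2 ^ (k + j)))"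
    by (intro suminf_le ann) auto
  also have "\<dots> = ennreal (2 * a / 2 ^ k)"
  proof (rule suminf_ennreal_eq)
    have "(\<lambda>j. a / 2 ^ k * (1/2) ^ j) sums (a / 2 ^ k * (1 / (1 - 1/2)))"
      by (intro sums_mult geometric_sums) simp
    then show "(\<lambda>j. a / 2 ^ (k + j)) sums (2 * a / 2 ^ k)"
      by (simp add: power_add power_divide field_simps)
  qed (use a in simp)
  finally show ?thesis .
qed

lemma borel_measurable_lebesgue_dual:
  fixes \<omega> :: "real \<Rightarrow> real"
  assumes [measurable]: "\<omega> \<in> borel_measurable lebesgue"
  shows "(\<lambda>r. 1 / ennreal (\<omega> r powr a)) \<in> borel_measurable lebesgue"
  unfolding divide_ennreal_def by measurable

lemma radial_measurable_real:
  fixes \<omega> :: "real \<Rightarrow> real"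
  assumes w: "\<omega> \<in> borel_measurable lebesgue" and nonneg: "\<And>r. 0 \<le> \<omega> r"
  shows "(\<lambda>z. \<omega> (norm z)) \<in> borel_measurable disc_area"
proof -
  have "(\<lambda>z. ennreal (\<omega> (norm z))) \<in> borel_measurable disc_area"
    by (rule radial_measurable) (use w in measurable)
  then have "(\<lambda>z. enn2real (ennreal (\<omega> (norm z)))) \<in> borel_measurable disc_area"
    by measurable
  then show ?thesis using nonneg by simp
qed

text \<open>
  The contribution of one box. Here \<open>(1 - t) q = - 1 / 2\<close>, so the factor
  \<open>(box_area k powr (1 - t)) powr q\<close> is at most \<open>2 ^ k\<close>, while the integral of the dual weight over
  the box is at most of order \<open>1 / 4 ^ k\<close>: one power of the length of the arc remains, and lengths
  of disjoint arcs add up to at most one.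
\<close>

lemma box_average_le:
  fixes t s a :: real and \<omega> :: "real \<Rightarrow> real" and f :: "complex \<Rightarrow> complex"
  assumes D: "dyadic_system \<D>" and I: "I \<in> \<D> k"
    and t: "1 < t" "t < 3 / 2" and s: "s > 0" and a: "a \<ge> 0"
    and w [measurable]: "\<omega> \<in> borel_measurable lebesgue" and nonneg: "\<And>r. 0 \<le> \<omega> r"
    and f [measurable]: "f \<in> borel_measurable disc_area"
    and tail: "(\<integral>\<^sup>+r\<in>{1 - 1 / 2 ^ k..<1}. 1 / ennreal (\<omega> r powr ((3 - 2 * t) / (2 * t - 2)))
        \<partial>lebesgue)
      \<le> ennreal (a / 2 ^ k)"
  defines "p \<equiv> 1 / (3 - 2 * t)" and "q \<equiv> 1 / (2 * t - 2)"
  shows "ennreal (box_area k powr (1 - t)) * (\<integral>\<^sup>+z\<in>carleson_box I. ennreal (norm (f z)) \<partial>disc_area)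
    \<le> ennreal (s powr p / p) * (\<integral>\<^sup>+z\<in>carleson_box I. ennreal (norm (f z) powr p * \<omega> (norm z)) \<partial>disc_area)
      + ennreal (2 * a * s powr (- q) / q) * ennreal (1 / 2 ^ k)"
proof -
  let ?m = "box_area k" and ?Q = "carleson_box I" and ?M = disc_area
  let ?\<sigma> = "\<lambda>r. 1 / ennreal (\<omega> r powr (q / p))"
  have pq: "p > 1" "q > 1" "1 / p + 1 / q = 1" using t by (auto simp: p_def q_def field_simps)
  have qp: "q / p = (3 - 2 * t) / (2 * t - 2)" by (simp add: p_def q_def)
  have m: "?m > 0" by (rule box_area_pos)
  define W where "W = ?m powr (1 - t)"
  have W: "W > 0" using m by (simp add: W_def)
  have Q [measurable]: "?Q \<in> sets ?M" by (rule box_sets[OF D I])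
  have wM [measurable]: "(\<lambda>z. \<omega> (norm z)) \<in> borel_measurable ?M"
    by (rule radial_measurable_real[OF w nonneg])
  have sL: "?\<sigma> \<in> borel_measurable lebesgue" by (rule borel_measurable_lebesgue_dual[OF w])
  have sM [measurable]: "(\<lambda>z. ?\<sigma> (norm z)) \<in> borel_measurable ?M"
    by (rule radial_measurable[OF sL])
  have "ennreal W * (\<integral>\<^sup>+z\<in>?Q. ennreal (norm (f z)) \<partial>?M) = (\<integral>\<^sup>+z\<in>?Q. ennreal (norm (f z) * W) \<partial>?M)"
    using W by (subst nn_integral_cmult[symmetric]) (auto intro!: nn_integral_cong
        simp: ennreal_mult mult_ac)
  also have "\<dots> \<le> (\<integral>\<^sup>+z. ennreal (s powr p / p) * (ennreal (norm (f z) powr p * \<omega> (norm z))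
      * indicator ?Q z)
      + ennreal (W powr q * s powr (- q) / q) * (?\<sigma> (norm z) * indicator ?Q z) \<partial>?M)"
  proof (rule nn_integral_mono)
    fix z
    show "ennreal (norm (f z) * W) * indicator ?Q z
        \<le> ennreal (s powr p / p) * (ennreal (norm (f z) powr p * \<omega> (norm z)) * indicator ?Q z)
      + ennreal (W powr q * s powr (- q) / q) * (?\<sigma> (norm z) * indicator ?Q z)"
      using weighted_Young[OF pq s W, of "norm (f z)" "\<omega> (norm z)"] nonneg[of "norm z"]
      by (cases "z \<in> ?Q") simp_all
  qed
  also have "\<dots> = ennreal (s powr p / p) * (\<integral>\<^sup>+z\<in>?Q. ennreal (norm (f z) powr p * \<omega> (norm z)) \<partial>?M)
      + ennreal (W powr q * s powr (- q) / q) * (\<integral>\<^sup>+z\<in>?Q. ?\<sigma> (norm z) \<partial>?M)"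
    by (subst nn_integral_add, measurable, measurable) (simp add: nn_integral_cmult)
  also have "\<dots> \<le> ennreal (s powr p / p) * (\<integral>\<^sup>+z\<in>?Q. ennreal (norm (f z) powr p * \<omega> (norm z)) \<partial>?M)
      + ennreal (2 * a * s powr (- q) / q) * ennreal (1 / 2 ^ k)"
  proof (rule add_left_mono)
    define d :: real where "d = 1 / 2 ^ k"
    have d: "d > 0" by (simp add: d_def)
    have "(\<integral>\<^sup>+z\<in>?Q. ?\<sigma> (norm z) \<partial>?M)
        = ennreal d * (\<integral>\<^sup>+r\<in>{1 - d..<1}. ennreal (2 * r) * ?\<sigma> r \<partial>lebesgue)"
      unfolding d_def by (rule radial_integral_box[OF D sL I])
    also have "(\<integral>\<^sup>+r\<in>{1 - d..<1}. ennreal (2 * r) * ?\<sigma> r \<partial>lebesgue)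
        \<le> (\<integral>\<^sup>+r. 2 * (?\<sigma> r * indicator {1 - d..<1} r) \<partial>lebesgue)"
    proof (rule nn_integral_mono)
      fix r :: real
      have "ennreal (2 * r) \<le> 2" if "r < 1"
        using ennreal_leI[of "2 * r" 2] that by simp
      then show "ennreal (2 * r) * ?\<sigma> r * indicator {1 - d..<1} r
          \<le> 2 * (?\<sigma> r * indicator {1 - d..<1} r)"
        by (cases "r \<in> {1 - d..<1}") (auto intro!: mult_right_mono)
    qed
    also have "\<dots> = 2 * (\<integral>\<^sup>+r\<in>{1 - d..<1}. ?\<sigma> r \<partial>lebesgue)"
      by (rule nn_integral_cmult) (intro borel_measurable_times_ennreal sL borel_measurable_indicator, simp)
    also have "\<dots> \<le> 2 * ennreal (a * d)"
      using tail unfolding qp d_def by (intro mult_left_mono) auto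
    finally have \<sigma>Q: "(\<integral>\<^sup>+z\<in>?Q. ?\<sigma> (norm z) \<partial>?M) \<le> ennreal d * (2 * ennreal (a * d))"
      by (simp add: mult_left_mono)
    have "W powr q = ?m powr (- 1 / 2)"
    proof -
      have "(1 - t) * q = - 1 / 2" using t by (simp add: q_def field_simps)
      then show ?thesis by (simp add: W_def powr_powr)
    qed
    also have "\<dots> \<le> (d\<^sup>2) powr (- 1 / 2)"
      using box_area_bounds(1)[of k] d by (intro powr_mono2') (auto simp: d_def)
    also have "\<dots> = 1 / d"
      using d by (simp add: powr_minus powr_half_sqrt field_simps)
    finally have Wq: "W powr q \<le> 1 / d" .
    have "ennreal (W powr q * s powr (- q) / q) * (\<integral>\<^sup>+z\<in>?Q. ?\<sigma> (norm z) \<partial>?M)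
      \<le> ennreal (1 / d * (s powr (- q) / q)) * (ennreal d * (2 * ennreal (a * d)))"
    proof (intro mult_mono ennreal_leI)
      show "W powr q * s powr (- q) / q \<le> 1 / d * (s powr (- q) / q)"
        using mult_right_mono[OF Wq, of "s powr (- q) / q"] pq by simp
    qed (use \<sigma>Q in auto)
    also have "\<dots> = ennreal (2 * a * s powr (- q) / q) * ennreal d"
    proof -
      have "ennreal (1 / d * (s powr (- q) / q)) * (ennreal d * (2 * ennreal (a * d)))
         = ennreal (1 / d * (s powr (- q) / q) * (d * (2 * (a * d))))"
      proof -
        have "ennreal x * (ennreal d * (2 * ennreal y)) = ennreal (x * (d * (2 * y)))"
          if "x \<ge> 0" "y \<ge> 0" for x y
          using that d by (simp add: ennreal_mult)
        then show ?thesis using a d pq by simp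
      qed
      also have "\<dots> = ennreal (2 * a * s powr (- q) / q * d)"
        using d by (simp add: mult_ac)
      also have "\<dots> = ennreal (2 * a * s powr (- q) / q) * ennreal d"
        using a d pq by (intro ennreal_mult) auto
      finally show ?thesis .
    qed
    finally show "ennreal (W powr q * s powr (- q) / q) * (\<integral>\<^sup>+z\<in>?Q. ?\<sigma> (norm z) \<partial>?M)
       \<le> ennreal (2 * a * s powr (- q) / q) * ennreal (1 / 2 ^ k)" unfolding d_def .
  qed
  finally show ?thesis unfolding W_def .
qed

text \<open>
  A box with \<open>l < |Q| powr (- t) * \<integral>|f|\<close> has \<open>l |Q| \<le> |Q| powr (1 - t) * \<integral>|f|\<close>. Summing
  the previous estimate over disjoint boxes bounds the first terms by the integral of
  \<open>|f| powr p * \<omega>\<close> over the disc and the second ones by a constant.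
\<close>

lemma weak_type_estimate:
  fixes t s a :: real and \<omega> :: "real \<Rightarrow> real" and f :: "complex \<Rightarrow> complex"
  assumes D: "dyadic_system \<D>"
    and t: "1 < t" "t < 3 / 2" and s: "s > 0" and a: "a \<ge> 0" and l: "l > 0"
    and w [measurable]: "\<omega> \<in> borel_measurable lebesgue" and nonneg: "\<And>r. 0 \<le> \<omega> r"
    and f [measurable]: "f \<in> borel_measurable disc_area"
    and tail: "\<And>k. (\<integral>\<^sup>+r\<in>{1 - 1 / 2 ^ k..<1}. 1 / ennreal (\<omega> r powr ((3 - 2 * t) / (2 * t - 2)))
        \<partial>lebesgue)
      \<le> ennreal (a / 2 ^ k)"
  defines "p \<equiv> 1 / (3 - 2 * t)" and "q \<equiv> 1 / (2 * t - 2)"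
  shows "ennreal l * emeasure disc_area {z \<in> ball 0 1. dyadic_maximal \<D> t f z > ennreal l}
    \<le> ennreal (s powr p / p) * Lp_integral p (\<lambda>z. \<omega> (norm z)) f + ennreal (2 * a * s powr (- q) / q)"
  unfolding maximal_superlevel[OF D]
proof (rule emeasure_Union_boxes_le[OF D])
  let ?av = "\<lambda>I. \<integral>\<^sup>+w\<in>carleson_box I. ennreal (norm (f w)) \<partial>disc_area"
  let ?S = "{I \<in> (\<Union>k. \<D> k). ennreal l < ennreal (1 / measure disc_area (carleson_box I) powr t)
      * ?av I}"
  let ?g = "\<lambda>z. ennreal (norm (f z) powr p * \<omega> (norm z))"
  let ?c = "ennreal (s powr p / p)" and ?b = "ennreal (2 * a * s powr (- q) / q)"
  have wM [measurable]: "(\<lambda>z. \<omega> (norm z)) \<in> borel_measurable disc_area"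
    by (rule radial_measurable_real[OF w nonneg])
  show "?S \<subseteq> (\<Union>k. \<D> k)" by blast
  fix F assume F: "finite F" "F \<subseteq> ?S" "disjoint F"
  have sets: "carleson_box I \<in> sets disc_area" if "I \<in> F" for I
    using that F(2) box_sets[OF D] by blast
  have each: "ennreal l * emeasure disc_area (carleson_box I)
      \<le> ?c * (\<integral>\<^sup>+z\<in>carleson_box I. ?g z \<partial>disc_area) + ?b * ennreal (arc_length I)" if IF: "I \<in> F" for I
  proof -
    obtain k where I: "I \<in> \<D> k" and bad: "ennreal l < ennreal (1 / box_area k powr t) * ?av I"
      using F(2) IF measure_box[OF D] by fastforce
    have "ennreal l * emeasure disc_area (carleson_box I)
        \<le> ennreal (1 / box_area k powr t) * ?av I * ennreal (box_area k)"
      unfolding emeasure_box[OF D I] using bad by (intro mult_right_mono) auto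
    also have "\<dots> = ennreal (1 / box_area k powr t * box_area k) * ?av I"
    proof -
      have "ennreal x * A * ennreal y = ennreal (x * y) * A" if "x \<ge> 0" "y \<ge> 0" for x y A
        using that by (simp add: ennreal_mult mult_ac)
      then show ?thesis using box_area_pos[of k] by simp
    qed
    also have "1 / box_area k powr t * box_area k = box_area k powr (1 - t)"
      using box_area_pos[of k] by (simp add: powr_diff)
    also have "ennreal \<dots> * ?av I \<le> ?c * (\<integral>\<^sup>+z\<in>carleson_box I. ?g z \<partial>disc_area) + ?b
        * ennreal (1 / 2 ^ k)"
      unfolding p_def q_def by (rule box_average_le[OF D I t s a w nonneg f tail])
    finally show ?thesis by (simp add: dyadic_length[OF D I])
  qed
  have one: "(\<Sum>I\<in>F. arc_length I) \<le> 1"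
    by (rule sum_length_disjoint[OF D F(1) _ F(3)]) (use F(2) in blast)
  have disj: "disjoint_family_on carleson_box F"
    unfolding disjoint_family_on_def
  proof (intro ballI impI)
    fix I J assume "I \<in> F" "J \<in> F" "I \<noteq> J"
    then have "I \<inter> J = {}" using F(3) by (simp add: disjoint_def)
    then show "carleson_box I \<inter> carleson_box J = {}" by (auto simp: mem_carleson_box)
  qed
  have "ennreal l * (\<Sum>I\<in>F. emeasure disc_area (carleson_box I))
     = (\<Sum>I\<in>F. ennreal l * emeasure disc_area (carleson_box I))"
    by (rule sum_distrib_left)
  also have "\<dots> \<le> (\<Sum>I\<in>F. ?c * (\<integral>\<^sup>+z\<in>carleson_box I. ?g z \<partial>disc_area) + ?b * ennreal (arc_length I))"
    by (rule sum_mono) (rule each)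
  also have "\<dots> = ?c * (\<Sum>I\<in>F. \<integral>\<^sup>+z\<in>carleson_box I. ?g z \<partial>disc_area) + ?b * (\<Sum>I\<in>F.
      ennreal (arc_length I))"
    by (simp add: sum.distrib sum_distrib_left)
  also have "(\<Sum>I\<in>F. \<integral>\<^sup>+z\<in>carleson_box I. ?g z \<partial>disc_area)
      = (\<integral>\<^sup>+z. (\<Sum>I\<in>F. ?g z * indicator (carleson_box I) z) \<partial>disc_area)"
    by (rule nn_integral_sum[symmetric]) (use sets in measurable)
  also have "\<dots> \<le> (\<integral>\<^sup>+z. ?g z \<partial>disc_area)"
  proof (rule nn_integral_mono)
    fix z
    have "(\<Sum>I\<in>F. indicator (carleson_box I) z) = (indicator (\<Union>I\<in>F. carleson_box I) z :: ennreal)"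
      by (rule indicator_UN_disjoint[symmetric, OF F(1) disj])
    then show "(\<Sum>I\<in>F. ?g z * indicator (carleson_box I) z) \<le> ?g z"
      by (simp add: sum_distrib_left[symmetric] indicator_def)
  qed
  also have "\<dots> = Lp_integral p (\<lambda>z. \<omega> (norm z)) f" by (simp add: Lp_integral_def)
  also have "(\<Sum>I\<in>F. ennreal (arc_length I)) = ennreal (\<Sum>I\<in>F. arc_length I)"
    by (rule sum_ennreal) (simp add: arc_length_def)
  also have "?b * \<dots> \<le> ?b * 1"
    using one by (intro mult_left_mono) auto
  finally show "ennreal l * (\<Sum>I\<in>F. emeasure disc_area (carleson_box I))
      \<le> ?c * Lp_integral p (\<lambda>z. \<omega> (norm z)) f + ?b"
    by (simp add: mult_left_mono add_mono)
qed

text \<open>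
  Let \<open>p\<close> and \<open>q\<close> be the conjugate exponents of the weak-type estimate. If \<open>y\<close> is positive and
  bounds the integral of \<open>|f| powr p * \<omega>\<close>, the parameter
  \<open>s = y powr (- 1 / (p q))\<close> makes both terms of the weak-type estimate multiples of \<open>y powr (1 / p)\<close>.
  The integral itself is the right \<open>y\<close> unless it is zero; then \<open>y\<close> tends to zero.
\<close>

lemma weak_bound_sufficient:
  fixes t a :: real and \<omega> :: "real \<Rightarrow> real"
  assumes D: "dyadic_system \<D>" and t: "1 < t" "t < 3 / 2" and a: "a \<ge> 0"
    and w: "\<omega> \<in> borel_measurable lebesgue" and nonneg: "\<And>r. 0 \<le> \<omega> r"
    and ann: "\<And>k. (\<integral>\<^sup>+r\<in>{1 - 1 / 2 ^ k..1 - 1 / 2 ^ (k + 1)}.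
        1 / ennreal (\<omega> r powr ((3 - 2 * t) / (2 * t - 2))) \<partial>lebesgue) \<le> ennreal (a / 2 ^ k)"
  shows "bounded_Lp_weak_L1 (dyadic_maximal \<D> t) (1 / (3 - 2 * t)) (\<lambda>z. \<omega> (norm z))"
  unfolding bounded_Lp_weak_L1_def
proof (intro exI conjI ballI)
  define p q where "p = 1 / (3 - 2 * t)" and "q = 1 / (2 * t - 2)"
  have pq: "p > 1" "q > 1" "1 / p + 1 / q = 1" using t by (auto simp: p_def q_def field_simps)
  define C where "C = 1 / p + 4 * a / q"
  show C: "C \<ge> 0" using pq a by (simp add: C_def)
  have C0: "C > 0" using pq a by (auto simp: C_def intro!: add_pos_nonneg)
  fix f assume "f \<in> Lp_space (1 / (3 - 2 * t)) (\<lambda>z. \<omega> (norm z))"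
  then have f: "f \<in> borel_measurable disc_area" and fin: "Lp_integral p (\<lambda>z. \<omega> (norm z)) f < \<infinity>"
    by (auto simp: Lp_space_def p_def)
  define x where "x = enn2real (Lp_integral p (\<lambda>z. \<omega> (norm z)) f)"
  have x: "Lp_integral p (\<lambda>z. \<omega> (norm z)) f = ennreal x" "x \<ge> 0" using fin by (auto simp: x_def)
  have tail: "(\<integral>\<^sup>+r\<in>{1 - 1 / 2 ^ k..<1}. 1 / ennreal (\<omega> r powr ((3 - 2 * t) / (2 * t - 2)))
      \<partial>lebesgue)
      \<le> ennreal (2 * a / 2 ^ k)" for k
    by (rule tail_integral_le[OF borel_measurable_lebesgue_dual[OF w] a ann])
  show "weak_L1_norm (dyadic_maximal \<D> t f)
      \<le> ennreal (C * Lp_norm (1 / (3 - 2 * t)) (\<lambda>z. \<omega> (norm z)) f)"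
    unfolding weak_L1_norm_def
  proof (rule SUP_least)
    fix l :: real assume "l \<in> {0<..}"
    then have l: "l > 0" by simp
    let ?E = "ennreal l * emeasure disc_area {z \<in> ball 0 1. dyadic_maximal \<D> t f z > ennreal l}"
    have E: "?E \<le> ennreal (C * y powr (1 / p))" if y: "y > 0" "x \<le> y" for y
    proof -
      define s where "s = y powr (- 1 / (p * q))"
      have s: "s > 0" using y by (simp add: s_def)
      have sp: "s powr p * y = y powr (1 / p)"
      proof -
        have "s powr p * y = y powr (- 1 / q) * y powr 1"
          using y pq by (simp add: s_def powr_powr)
        also have "\<dots> = y powr (- 1 / q + 1)" by (rule powr_add[symmetric])
        also have "- 1 / q + 1 = 1 / p" using pq(3) by simp
        finally show ?thesis .
      qed
      have sq: "s powr (- q) = y powr (1 / p)"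
        using y pq by (simp add: s_def powr_powr)
      have "?E \<le> ennreal (s powr p / p) * ennreal x + ennreal (2 * (2 * a) * s powr (- q) / q)"
        using weak_type_estimate[OF D t s _ l w nonneg f tail] a unfolding p_def[symmetric] q_def[symmetric] x(1) by simp
      also have "\<dots> = ennreal (s powr p / p * x + 2 * (2 * a) * s powr (- q) / q)"
      proof -
        have "ennreal A * ennreal x + ennreal B = ennreal (A * x + B)" if "A \<ge> 0" "B \<ge> 0" for A B
          using that x(2) by (simp add: ennreal_mult)
        then show ?thesis using pq a by simp
      qed
      also have "\<dots> \<le> ennreal (s powr p / p * y + 2 * (2 * a) * s powr (- q) / q)"
        using y pq by (intro ennreal_leI add_mono mult_left_mono) auto
      also have "s powr p / p * y + 2 * (2 * a) * s powr (- q) / q = C * y powr (1 / p)"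
        unfolding sq using sp by (simp add: C_def field_simps)
      finally show ?thesis .
    qed
    have "?E \<le> ennreal (C * x powr (1 / p))"
    proof (cases "x = 0")
      case True
      have "?E \<le> 0"
      proof (rule ennreal_le_epsilon)
        fix e :: real assume e: "e > 0"
        have "((e / C) powr p) powr (1 / p) = e / C" using e C0 pq by (simp add: powr_powr)
        then show "?E \<le> 0 + ennreal e"
          using E[of "(e / C) powr p"] True e C0 by simp
      qed
      then show ?thesis by (rule order_trans) simp
    qed (use E[of x] x(2) in auto)
    then show "?E \<le> ennreal (C * Lp_norm (1 / (3 - 2 * t)) (\<lambda>z. \<omega> (norm z)) f)"
      unfolding Lp_norm_def p_def[symmetric] x_def .
  qed
qed

section \<open>Necessity\<close>

lemma superlevel_sets:
  assumes D: "dyadic_system \<D>"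
  shows "{z \<in> ball 0 1. dyadic_maximal \<D> t f z > ennreal s} \<in> sets disc_area"
proof -
  have c: "countable (\<Union>k. \<D> k)"
    by (rule countable_UN) (simp_all add: countable_finite dyadic_finite[OF D])
  show ?thesis
    unfolding maximal_superlevel[OF D]
    by (rule sets.countable_UN'[OF countable_subset[OF _ c]]) (use box_sets[OF D] in blast)+
qed

lemma arc_length_UNIV [simp]: "arc_length UNIV = 1"
proof -
  have "{\<theta>\<in>{0..<1}. cis (2 * pi * \<theta>) \<in> UNIV} = {0..<1::real}" by auto
  then show ?thesis unfolding arc_length_def by simp
qed

lemma radial_integral_disc:
  assumes "h \<in> borel_measurable lebesgue"
  shows "(\<integral>\<^sup>+z. h (norm z) \<partial>disc_area) = (\<integral>\<^sup>+r\<in>{0..<1}. ennreal (2 * r) * h r \<partial>lebesgue)"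
  using disc_polar[OF assms, of UNIV] by simp

lemma emeasure_outer_annulus:
  assumes "0 \<le> d" "d \<le> 1"
  shows "ennreal d \<le> emeasure disc_area {z \<in> ball 0 1. 1 - d \<le> norm z}"
proof -
  have R: "{z \<in> ball 0 1. 1 - d \<le> norm z} \<in> sets disc_area"
  proof (rule borel_sets_disc_area)
    have "{z \<in> ball 0 1. 1 - d \<le> norm z} = {z. norm z < 1} \<inter> {z :: complex. 1 - d \<le> norm z}" by auto
    also have "\<dots> \<in> sets borel" by measurable
    finally show "{z \<in> ball 0 1. 1 - d \<le> norm z} \<in> sets (borel :: complex measure)" .
  qed auto
  have "d \<le> 1 - (1 - d)\<^sup>2"
    using assms mult_left_mono[of d 1 d] by (simp add: power2_eq_square algebra_simps)
  then have "ennreal d \<le> (\<integral>\<^sup>+r\<in>{1 - d..<1}. ennreal (2 * r) \<partial>lebesgue)"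
    using assms by (subst nn_integral_2r) (auto intro: ennreal_leI)
  also have "\<dots> = (\<integral>\<^sup>+r\<in>{0..<1}. ennreal (2 * r) * indicator {1 - d..<1} r \<partial>lebesgue)"
    using assms by (intro nn_integral_cong) (auto simp: indicator_def)
  also have "\<dots> = (\<integral>\<^sup>+z. indicator {1 - d..<1} (norm z) \<partial>disc_area)"
    by (rule radial_integral_disc[symmetric]) (intro borel_measurable_indicator, simp)
  also have "\<dots> = (\<integral>\<^sup>+z. indicator {z \<in> ball 0 1. 1 - d \<le> norm z} z \<partial>disc_area)"
    by (intro nn_integral_cong) (auto simp: indicator_def)
  also have "\<dots> = emeasure disc_area {z \<in> ball 0 1. 1 - d \<le> norm z}"
    by (rule nn_integral_indicator[OF R])
  finally show ?thesis .
qed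

text \<open>
  Let \<open>p = 1 / (3 - 2 t)\<close> and \<open>q = 1 / (p - 1)\<close>. The test function is \<open>\<phi> (norm z)\<close> with
  \<open>\<phi> = (\<omega> + e) powr (- q)\<close> on the \<open>k\<close>-th dyadic annulus and \<open>0\<close> elsewhere. The parameter
  \<open>e\<close> keeps \<open>\<phi>\<close> bounded, so that \<open>F = \<integral>\<phi>\<close> is finite and can be cancelled, and
  \<open>1 - q p = - q\<close> gives \<open>\<phi> powr p * \<omega> \<le> \<phi>\<close>; the norm is thus at most \<open>(2 F) powr (1 / p)\<close>. As \<open>\<phi>\<close>
  is radial, every box of generation \<open>k\<close> carries the same integral, of order \<open>F / 2 ^ k\<close>; hence the
  maximal function is at least a constant \<open>L\<close> on the whole annulus \<open>1 - 1 / 2 ^ k \<le> norm z\<close>, of area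
  at least \<open>1 / 2 ^ k\<close>. The weak-type bound then reads
  \<open>F powr (1 - 1 / p) \<le> K * (1 / 2 ^ k) powr (1 - 1 / p)\<close> with a constant \<open>K\<close>, where
  \<open>1 - 1 / p = 2 t - 2\<close>. The condition \<open>k \<ge> 1\<close> makes the Jacobian \<open>2 r\<close> at least \<open>1\<close> on the annulus.
\<close>

lemma regularized_dual_integral_le:
  fixes t C e :: real and \<omega> :: "real \<Rightarrow> real"
  assumes D: "dyadic_system \<D>" and t: "1 < t" "t < 3 / 2"
    and w [measurable]: "\<omega> \<in> borel_measurable lebesgue" and nonneg: "\<And>r. 0 \<le> \<omega> r"
    and C: "C \<ge> 0"
    and bound: "\<And>f. f \<in> Lp_space (1 / (3 - 2 * t)) (\<lambda>z. \<omega> (norm z)) \<Longrightarrow>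
      weak_L1_norm (dyadic_maximal \<D> t f) \<le> ennreal (C * Lp_norm (1 / (3 - 2 * t)) (\<lambda>z. \<omega> (norm z)) f)"
    and k: "k \<ge> 1" and e: "e > 0"
  shows "(\<integral>\<^sup>+r\<in>{1 - 1 / 2 ^ k..1 - 1 / 2 ^ (k + 1)}.
      ennreal ((\<omega> r + e) powr (- ((3 - 2 * t) / (2 * t - 2)))) \<partial>lebesgue)
    \<le> ennreal ((C * 2 powr (4 - t)) powr (1 / (2 * t - 2)) / 2 ^ k)"
proof -
  define d :: real where "d = 1 / 2 ^ k"
  have d: "0 < d" "d \<le> 1 / 2"
  proof -
    have "(2::real) ^ 1 \<le> 2 ^ k" using k by (intro power_increasing) auto
    then show "0 < d" "d \<le> 1 / 2" by (simp_all add: d_def field_simps)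
  qed
  define A :: "real set" where "A = {1 - d..1 - d / 2}"
  have A [measurable]: "A \<in> sets lebesgue" by (simp add: A_def)
  have A_iff: "{1 - 1 / 2 ^ k..1 - 1 / 2 ^ (k + 1)} = A"
    by (simp add: A_def d_def)
  define p q :: real where "p = 1 / (3 - 2 * t)" and "q = (3 - 2 * t) / (2 * t - 2)"
  have p: "p > 1" and q: "q > 0" using t by (auto simp: p_def q_def field_simps)
  have pq: "1 - q * p = - q" using t by (simp add: p_def q_def field_simps)
  have ip: "1 / p = 3 - 2 * t" by (simp add: p_def)
  define \<phi> where "\<phi> r = (\<omega> r + e) powr (- q) * indicator A r" for r
  have \<phi> [measurable]: "\<phi> \<in> borel_measurable lebesgue"
    unfolding \<phi>_def by measurable
  have \<phi>_nonneg: "\<phi> r \<ge> 0" for r by (simp add: \<phi>_def)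
  have \<phi>_le: "\<phi> r \<le> e powr (- q) * indicator A r" for r
    unfolding \<phi>_def using e q nonneg[of r] by (intro mult_right_mono powr_mono2') auto
  define FF where "FF = (\<integral>\<^sup>+r. ennreal (\<phi> r) \<partial>lebesgue)"
  have "FF \<le> (\<integral>\<^sup>+r. ennreal (e powr (- q)) * indicator A r \<partial>lebesgue)"
    unfolding FF_def
  proof (rule nn_integral_mono)
    fix r show "ennreal (\<phi> r) \<le> ennreal (e powr (- q)) * indicator A r"
      using ennreal_leI[OF \<phi>_le[of r]] by (cases "r \<in> A") (auto simp: indicator_def)
  qed
  also have "\<dots> = ennreal (e powr (- q)) * emeasure lebesgue A"
    by (rule nn_integral_cmult_indicator) (rule A)
  also have "\<dots> < \<infinity>"
    using d by (simp add: A_def ennreal_mult[symmetric])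
  finally have "FF < \<infinity>" .
  define F where "F = enn2real FF"
  have FF: "FF = ennreal F" using \<open>FF < \<infinity>\<close> by (simp add: F_def)
  have F0: "F \<ge> 0" by (simp add: F_def)
  define f where "f z = complex_of_real (\<phi> (norm z))" for z :: complex
  have nf: "norm (f z) = \<phi> (norm z)" for z using \<phi>_nonneg by (simp add: f_def)
  have \<phi>L: "(\<lambda>r. ennreal (\<phi> r)) \<in> borel_measurable lebesgue" by measurable
  have "(\<lambda>z. enn2real (ennreal (\<phi> (norm z)))) \<in> borel_measurable disc_area"
    using radial_measurable[OF \<phi>L] by measurable
  then have "(\<lambda>z. \<phi> (norm z)) \<in> borel_measurable disc_area"
    using \<phi>_nonneg by simp
  then have fM: "f \<in> borel_measurable disc_area"
    unfolding f_def by measurable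
  have Lp: "Lp_integral p (\<lambda>z. \<omega> (norm z)) f \<le> ennreal (2 * F)"
  proof -
    have "Lp_integral p (\<lambda>z. \<omega> (norm z)) f \<le> (\<integral>\<^sup>+z. ennreal (\<phi> (norm z)) \<partial>disc_area)"
      unfolding Lp_integral_def nf
    proof (rule nn_integral_mono, rule ennreal_leI)
      fix z
      let ?v = "\<omega> (norm z)"
      have "((?v + e) powr (- q)) powr p * ?v \<le> ((?v + e) powr (- q)) powr p * (?v + e) powr 1"
        using e nonneg[of "norm z"] by (intro mult_left_mono) auto
      also have "\<dots> = (?v + e) powr (- q)"
        using pq by (simp add: powr_powr powr_add[symmetric] del: powr_one_gt_zero_iff powr_one' powr_one)
      finally show "\<phi> (norm z) powr p * ?v \<le> \<phi> (norm z)"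
        by (simp add: \<phi>_def indicator_def)
    qed
    also have "\<dots> = (\<integral>\<^sup>+r\<in>{0..<1}. ennreal (2 * r) * ennreal (\<phi> r) \<partial>lebesgue)"
      by (rule radial_integral_disc[OF \<phi>L])
    also have "\<dots> \<le> (\<integral>\<^sup>+r. 2 * ennreal (\<phi> r) \<partial>lebesgue)"
    proof (rule nn_integral_mono)
      fix r :: real
      have "ennreal (2 * r) \<le> 2" if "r < 1"
        using ennreal_leI[of "2 * r" 2] that by simp
      then show "ennreal (2 * r) * ennreal (\<phi> r) * indicator {0..<1} r \<le> 2 * ennreal (\<phi> r)"
        by (cases "r \<in> {0..<1}") (auto intro!: mult_right_mono)
    qed
    also have "\<dots> = 2 * FF" unfolding FF_def by (rule nn_integral_cmult[OF \<phi>L])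
    also have "\<dots> = ennreal (2 * F)" using F0 by (simp add: FF ennreal_mult)
    finally show ?thesis .
  qed
  then have fLp: "f \<in> Lp_space p (\<lambda>z. \<omega> (norm z))"
    using fM by (auto simp: Lp_space_def intro: le_less_trans)
  have norm_le: "Lp_norm p (\<lambda>z. \<omega> (norm z)) f \<le> (2 * F) powr (3 - 2 * t)"
  proof -
    have "enn2real (Lp_integral p (\<lambda>z. \<omega> (norm z)) f) \<le> 2 * F"
      using enn2real_mono[OF Lp] F0 by simp
    then show ?thesis
      unfolding Lp_norm_def ip using t by (intro powr_mono2) auto
  qed
  define L where "L = d * F / (2 * d\<^sup>2) powr t"
  have large: "ennreal L \<le> dyadic_maximal \<D> t f z" if z: "z \<in> ball 0 1" "1 - d \<le> norm z" for z
  proof -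
    have "z \<noteq> 0" using z d by auto
    then have "sgn z \<in> sphere 0 1" by (simp add: norm_sgn)
    then obtain I where I: "I \<in> \<D> k" "sgn z \<in> I" using dyadic_cover[OF D] by blast
    have zI: "z \<in> carleson_box I"
      using z I(2) by (simp add: mem_carleson_box dyadic_length[OF D I(1)] d_def)
    have "FF \<le> (\<integral>\<^sup>+r\<in>{1 - d..<1}. ennreal (2 * r) * ennreal (\<phi> r) \<partial>lebesgue)"
      unfolding FF_def
    proof (rule nn_integral_mono)
      fix r :: real
      show "ennreal (\<phi> r) \<le> ennreal (2 * r) * ennreal (\<phi> r) * indicator {1 - d..<1} r"
      proof (cases "r \<in> A")
        case True
        then have "1 \<le> 2 * r" "r \<in> {1 - d..<1}" using d by (auto simp: A_def)
        then have "1 \<le> ennreal (2 * r)" using ennreal_leI[of 1 "2 * r"] by simp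
        then show ?thesis using \<open>r \<in> {1 - d..<1}\<close> mult_right_mono[of 1 "ennreal (2
            * r)" "ennreal (\<phi> r)"] by simp
      qed (simp add: \<phi>_def)
    qed
    then have "ennreal d * FF \<le> (\<integral>\<^sup>+w\<in>carleson_box I. ennreal (\<phi> (norm w)) \<partial>disc_area)"
      unfolding radial_integral_box[OF D \<phi>L I(1)] d_def by (rule mult_left_mono) simp
    moreover have "1 / (2 * d\<^sup>2) powr t \<le> 1 / box_area k powr t"
      using box_area_bounds(2)[of k] box_area_pos[of k] t
      by (intro divide_left_mono powr_mono2) (auto simp: d_def)
    ultimately have "ennreal (1 / (2 * d\<^sup>2) powr t) * (ennreal d * FF)
      \<le> ennreal (1 / measure disc_area (carleson_box I) powr t) * (\<integral>\<^sup>+w\<in>carleson_box I. ennreal (norm (f w)) \<partial>disc_area)"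
      unfolding measure_box[OF D I(1)] nf by (intro mult_mono ennreal_leI) auto
    also have "\<dots> \<le> dyadic_maximal \<D> t f z"
      unfolding dyadic_maximal_def by (rule SUP_upper) (use I(1) zI in blast)
    also have "ennreal (1 / (2 * d\<^sup>2) powr t) * (ennreal d * FF) = ennreal L"
      using F0 d by (simp add: FF L_def ennreal_mult[symmetric])
    finally show ?thesis .
  qed
  have "F \<le> (C * 2 powr (4 - t)) powr (1 / (2 * t - 2)) * d"
  proof (cases "F = 0")
    case False
    then have F: "F > 0" using F0 by simp
    then have L: "L > 0" using d by (simp add: L_def)
    (* The superlevel sets are strict, so the level is taken below L. *)
    have "{z \<in> ball 0 1. 1 - d \<le> norm z} \<subseteq> {z \<in> ball 0 1. dyadic_maximal \<D> t f z > ennreal (L / 2)}"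
    proof safe
      fix z :: complex assume z: "z \<in> ball 0 1" "1 - d \<le> norm z"
      have "ennreal (L / 2) < ennreal L" using L by (intro ennreal_lessI) auto
      also have "\<dots> \<le> dyadic_maximal \<D> t f z" by (rule large[OF z])
      finally show "dyadic_maximal \<D> t f z > ennreal (L / 2)" .
    qed
    then have "ennreal d \<le> emeasure disc_area {z \<in> ball 0 1.
        dyadic_maximal \<D> t f z > ennreal (L / 2)}"
      using emeasure_outer_annulus[of d] d emeasure_mono[OF _ superlevel_sets[OF D]]
      by (auto intro: order_trans)
    then have "ennreal (L / 2) * ennreal d
        \<le> ennreal (L / 2) * emeasure disc_area {z \<in> ball 0 1. dyadic_maximal \<D> t f z > ennreal (L / 2)}"
      by (rule mult_left_mono) simp
    also have "\<dots> \<le> weak_L1_norm (dyadic_maximal \<D> t f)"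
      unfolding weak_L1_norm_def by (rule SUP_upper) (use L in simp)
    also have "\<dots> \<le> ennreal (C * Lp_norm p (\<lambda>z. \<omega> (norm z)) f)"
      using bound fLp unfolding p_def by blast
    also have "\<dots> \<le> ennreal (C * (2 * F) powr (3 - 2 * t))"
      using norm_le C by (intro ennreal_leI mult_left_mono)
    finally have "L / 2 * d \<le> C * (2 * F) powr (3 - 2 * t)"
      using C L d by (simp add: ennreal_mult[symmetric] ennreal_le_iff)
    then have main: "d\<^sup>2 * F \<le> C * 2 * (2 * F) powr (3 - 2 * t) * (2 * d\<^sup>2) powr t"
      using d by (simp add: L_def field_simps power2_eq_square)
    have "F powr (2 * t - 2) = F / F powr (3 - 2 * t)"
      using F powr_diff[of F 1 "3 - 2 * t"] by simp
    also have "\<dots> = (d\<^sup>2 * F) / (d\<^sup>2 * F powr (3 - 2 * t))"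
      using d by simp
    also have "\<dots> \<le> (C * 2 * (2 * F) powr (3 - 2 * t) * (2 * d\<^sup>2) powr t) / (d\<^sup>2 * F powr (3 - 2
        * t))"
      using main d F by (intro divide_right_mono) auto
    also have "\<dots> = C * 2 * 2 powr (3 - 2 * t) * 2 powr t * ((d\<^sup>2) powr t / d\<^sup>2)"
      using F d by (simp add: powr_mult)
    also have "(d\<^sup>2) powr t / d\<^sup>2 = d powr (2 * t - 2)"
      using d by (simp add: powr_diff powr_powr flip: powr_numeral)
    also have "C * 2 * 2 powr (3 - 2 * t) * 2 powr t = C * 2 powr (4 - t)"
      by (simp add: powr_add[symmetric] powr_mult_base mult.assoc)
    finally have "F powr (2 * t - 2) \<le> C * 2 powr (4 - t) * d powr (2 * t - 2)" .
    then have "(F powr (2 * t - 2)) powr (1 / (2 * t - 2))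
        \<le> (C * 2 powr (4 - t) * d powr (2 * t - 2)) powr (1 / (2 * t - 2))"
      using t by (intro powr_mono2) auto
    then show ?thesis
      using F d t C by (simp add: powr_powr powr_mult)
  qed (use d in simp)
  then have "FF \<le> ennreal ((C * 2 powr (4 - t)) powr (1 / (2 * t - 2)) / 2 ^ k)"
    unfolding FF by (intro ennreal_leI) (simp add: d_def)
  moreover have "FF = (\<integral>\<^sup>+r\<in>A. ennreal ((\<omega> r + e) powr (- q)) \<partial>lebesgue)"
    unfolding FF_def \<phi>_def by (intro nn_integral_cong) (simp add: indicator_def)
  ultimately show ?thesis
    unfolding A_iff q_def by simp
qed

text \<open>
  At \<open>v = 0\<close> both sides are infinite, so the dual weight is recovered even where the weight
  vanishes.
\<close>

lemma SUP_regularized_dual: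
  fixes v q :: real
  assumes v: "v \<ge> 0" and q: "q > 0"
  shows "1 / ennreal (v powr q) = (SUP n. ennreal ((v + 1 / real (Suc n)) powr (- q)))"
proof -
  let ?g = "\<lambda>n. (v + 1 / real (Suc n)) powr (- q)"
  have inc: "incseq (\<lambda>n. ennreal (?g n))"
  proof (rule incseq_SucI, rule ennreal_leI)
    fix n
    have "1 / real (Suc (Suc n)) \<le> 1 / real (Suc n)" by (rule divide_left_mono) auto
    then show "?g n \<le> ?g (Suc n)"
      using v q by (intro powr_mono2') (auto intro!: add_nonneg_pos)
  qed
  have "(\<lambda>n. v + 1 / real (Suc n)) \<longlonglongrightarrow> v + 0"
    by (intro tendsto_add tendsto_const LIMSEQ_Suc[OF lim_1_over_n])
  then have lim: "(\<lambda>n. v + 1 / real (Suc n)) \<longlonglongrightarrow> v" by simp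
  have "(\<lambda>n. ennreal (?g n)) \<longlonglongrightarrow> 1 / ennreal (v powr q)"
  proof (cases "v = 0")
    case True
    have "filterlim (\<lambda>n. (1 / real (Suc n)) powr (- q)) at_top sequentially"
    proof -
      have "filterlim (\<lambda>n. real (Suc n) powr q) at_top sequentially"
      proof -
        have "filterlim (\<lambda>n. exp (q * ln (real (Suc n)))) at_top sequentially"
          by (intro filterlim_compose[OF exp_at_top] filterlim_tendsto_pos_mult_at_top[OF tendsto_const q]
              filterlim_compose[OF ln_at_top] filterlim_compose[OF filterlim_real_sequentially filterlim_Suc])
        then show ?thesis by (simp add: powr_def)
      qed
      then show ?thesis by (simp add: powr_minus powr_divide)
    qed
    then have "(\<lambda>n. ennreal ((1 / real (Suc n)) powr (- q))) \<longlonglongrightarrow> top"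
      by (rule ennreal_tendsto_top_eq_at_top[THEN iffD2])
    moreover have "1 / ennreal (v powr q) = top" using True by (simp add: ennreal_divide_zero)
    ultimately show ?thesis using True by simp
  next
    case False
    with v have "v > 0" by simp
    have "(\<lambda>n. ennreal (?g n)) \<longlonglongrightarrow> ennreal (v powr (- q))"
      using \<open>v > 0\<close> by (intro tendsto_ennrealI tendsto_powr lim tendsto_const) auto
    also have "ennreal (v powr (- q)) = 1 / ennreal (v powr q)"
      using \<open>v > 0\<close> by (simp add: powr_minus divide_ennreal inverse_eq_divide flip: ennreal_1)
    finally show ?thesis .
  qed
  then show ?thesis by (rule LIMSEQ_unique[OF _ LIMSEQ_SUP[OF inc]])
qed

lemma dual_integral_le:
  fixes t C :: real and \<omega> :: "real \<Rightarrow> real"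
  assumes D: "dyadic_system \<D>" and t: "1 < t" "t < 3 / 2"
    and w [measurable]: "\<omega> \<in> borel_measurable lebesgue" and nonneg: "\<And>r. 0 \<le> \<omega> r"
    and C: "C \<ge> 0"
    and bound: "\<And>f. f \<in> Lp_space (1 / (3 - 2 * t)) (\<lambda>z. \<omega> (norm z)) \<Longrightarrow>
      weak_L1_norm (dyadic_maximal \<D> t f) \<le> ennreal (C * Lp_norm (1 / (3 - 2 * t)) (\<lambda>z. \<omega> (norm z)) f)"
    and k: "k \<ge> 1"
  shows "(\<integral>\<^sup>+r\<in>{1 - 1 / 2 ^ k..1 - 1 / 2 ^ (k + 1)}. 1 / ennreal (\<omega> r powr ((3 - 2 * t) / (2
      * t - 2))) \<partial>lebesgue)
    \<le> ennreal ((C * 2 powr (4 - t)) powr (1 / (2 * t - 2)) / 2 ^ k)"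
proof -
  let ?A = "{1 - 1 / 2 ^ k..1 - 1 / 2 ^ (k + 1)} :: real set"
  let ?q = "(3 - 2 * t) / (2 * t - 2)"
  let ?g = "\<lambda>n r. ennreal ((\<omega> r + 1 / real (Suc n)) powr (- ?q)) * indicator ?A r"
  have q: "?q > 0" using t by simp
  have meas: "?g n \<in> borel_measurable lebesgue" for n
    by (intro borel_measurable_times_ennreal borel_measurable_indicator) (measurable, simp)
  have inc: "incseq ?g"
  proof (rule incseq_SucI, rule le_funI)
    fix n r
    have "1 / real (Suc (Suc n)) \<le> 1 / real (Suc n)" by (rule divide_left_mono) auto
    then have "(\<omega> r + 1 / real (Suc n)) powr (- ?q) \<le> (\<omega> r + 1 / real (Suc (Suc n))) powr (- ?q)"
      using nonneg[of r] q by (intro powr_mono2') (auto intro!: add_nonneg_pos)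
    then show "?g n r \<le> ?g (Suc n) r" by (intro mult_right_mono ennreal_leI) auto
  qed
  have "(\<integral>\<^sup>+r\<in>?A. 1 / ennreal (\<omega> r powr ?q) \<partial>lebesgue) = (\<integral>\<^sup>+r. (SUP n. ?g n r) \<partial>lebesgue)"
    unfolding SUP_regularized_dual[OF nonneg q] by (simp add: SUP_mult_right_ennreal)
  also have "\<dots> = (SUP n. \<integral>\<^sup>+r. ?g n r \<partial>lebesgue)"
    by (rule nn_integral_monotone_convergence_SUP[OF inc meas])
  also have "\<dots> \<le> ennreal ((C * 2 powr (4 - t)) powr (1 / (2 * t - 2)) / 2 ^ k)"
    by (intro SUP_least regularized_dual_integral_le[OF D t w nonneg C bound k]) auto
  finally show ?thesis .
qed

section \<open>The characterization\<close>

text \<open>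
  Local integrability gives measurability on each \<open>{0..1 - 1 / (n + 1)}\<close>; on \<open>{0..<1}\<close> the truncations
  converge.
\<close>

lemma weight_measurable:
  assumes "weight_on_unit_interval \<omega>"
  shows "(\<lambda>r. \<omega> r * indicator {0..<1} r) \<in> borel_measurable lebesgue"
proof (rule borel_measurable_LIMSEQ_real)
  let ?K = "\<lambda>n. {0..1 - 1 / real (Suc n)}"
  have K: "?K n \<subseteq> {0..<1}" for n
  proof
    fix r assume r: "r \<in> ?K n"
    have "0 < 1 / real (Suc n)" by simp
    then have "r < 1" using r unfolding atLeastAtMost_iff by linarith
    with r show "r \<in> {0..<1}" by simp
  qed
  show "(\<lambda>r. indicator (?K n) r *\<^sub>R \<omega> r) \<in> borel_measurable lebesgue" for n
  proof -
    have "compact (?K n)" by simp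
    with K[of n] have "set_integrable lebesgue (?K n) \<omega>"
      using assms unfolding weight_on_unit_interval_def by blast
    then show ?thesis unfolding set_integrable_def by (rule borel_measurable_integrable)
  qed
  fix r :: real
  show "(\<lambda>n. indicator (?K n) r *\<^sub>R \<omega> r) \<longlonglongrightarrow> \<omega> r * indicator {0..<1} r"
  proof (cases "r \<in> {0..<1}")
    case True
    have "\<forall>\<^sub>F n in sequentially. 1 / real (Suc n) < 1 - r"
      using True by (intro order_tendstoD[OF LIMSEQ_Suc[OF lim_1_over_n]]) auto
    then have "\<forall>\<^sub>F n in sequentially. indicator (?K n) r *\<^sub>R \<omega> r = \<omega> r * indicator {0..<1} r"
      by eventually_elim (use True in \<open>auto simp: indicator_def\<close>)
    then show ?thesis by (rule tendsto_eventually)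
  next
    case False
    then have "r \<notin> ?K n" for n using K[of n] by blast
    with False show ?thesis by simp
  qed
qed

theorem theorem3p5:
  fixes t c :: real and \<D> :: "nat \<Rightarrow> complex set set" and \<omega> :: "real \<Rightarrow> real"
  assumes "1 < t" and "t < 3 / 2"
    and "dyadic_system \<D>"
    and "weight_on_unit_interval \<omega>"
    and "c > 0" and "\<And>r. r \<in> {0..<1/2} \<Longrightarrow> \<omega> r \<ge> c"
  shows "bounded_Lp_weak_L1 (dyadic_maximal \<D> t) (1 / (3 - 2 * t)) (\<lambda>z. \<omega> (norm z)) \<longleftrightarrow>
    (SUP k::nat. 2 ^ k *
       (\<integral>\<^sup>+r\<in>{1 - 1 / 2 ^ k .. 1 - 1 / 2 ^ (k + 1)}.
          1 / ennreal (\<omega> r powr ((3 - 2 * t) / (2 * t - 2))) \<partial>lebesgue)) < \<infinity>"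
    (is "_ \<longleftrightarrow> (SUP k. 2 ^ k * ?J k) < \<infinity>")
proof -
  note t = assms(1,2) and D = assms(3) and c = assms(5,6)
  (* Outside [0,1) the weight may be negative or not measurable; truncation changes neither side. *)
  define v where "v r = \<omega> r * indicator {0..<1} r" for r
  have v: "v \<in> borel_measurable lebesgue" and nonneg: "0 \<le> v r" for r
    using weight_measurable[OF assms(4)] assms(4) unfolding v_def weight_on_unit_interval_def
    by (auto simp: indicator_def)
  have v_eq: "v r = \<omega> r" if "0 \<le> r" "r < 1" for r using that by (simp add: v_def)
  have J: "?J k = (\<integral>\<^sup>+r\<in>{1 - 1 / 2 ^ k .. 1 - 1 / 2 ^ (k + 1)}.
          1 / ennreal (v r powr ((3 - 2 * t) / (2 * t - 2))) \<partial>lebesgue)" for k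
  proof (intro nn_integral_cong)
    fix r :: real
    have ends: "(0::real) \<le> 1 - 1 / 2 ^ k" "1 - 1 / 2 ^ (k + 1) < (1::real)" by simp_all
    have "v r = \<omega> r" if "r \<in> {1 - 1 / 2 ^ k .. 1 - 1 / 2 ^ (k + 1)}"
    proof (rule v_eq)
      show "0 \<le> r" by (rule order_trans[OF ends(1)]) (use that in simp)
      show "r < 1" by (rule le_less_trans[OF _ ends(2)]) (use that in simp)
    qed
    then show "1 / ennreal (\<omega> r powr ((3 - 2 * t) / (2 * t - 2))) * indicator {1 - 1 / 2 ^ k ..
        1 - 1 / 2 ^ (k + 1)} r
      = 1 / ennreal (v r powr ((3 - 2 * t) / (2 * t - 2))) * indicator {1 - 1 / 2 ^ k .. 1 - 1 / 2 ^ (k + 1)} r"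
      by (cases "r \<in> {1 - 1 / 2 ^ k .. 1 - 1 / 2 ^ (k + 1)}") simp_all
  qed
  have Lp: "Lp_integral p (\<lambda>z. \<omega> (norm z)) f = Lp_integral p (\<lambda>z. v (norm z)) f" for p f
    unfolding Lp_integral_def by (intro nn_integral_cong) (simp add: v_eq)
  have B: "bounded_Lp_weak_L1 (dyadic_maximal \<D> t) (1 / (3 - 2 * t)) (\<lambda>z. \<omega> (norm z))
     \<longleftrightarrow> bounded_Lp_weak_L1 (dyadic_maximal \<D> t) (1 / (3 - 2 * t)) (\<lambda>z. v (norm z))"
    unfolding bounded_Lp_weak_L1_def Lp_space_def Lp_norm_def Lp ..
  have two: "2 ^ k = ennreal (2 ^ k)" for k :: nat by (simp add: ennreal_power[symmetric])
  show ?thesis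
    unfolding B
  proof
    assume "bounded_Lp_weak_L1 (dyadic_maximal \<D> t) (1 / (3 - 2 * t)) (\<lambda>z. v (norm z))"
    then obtain C where C: "C \<ge> 0" and bound: "\<And>f. f \<in> Lp_space (1 / (3 - 2 * t)) (\<lambda>z. v (norm z)) \<Longrightarrow>
      weak_L1_norm (dyadic_maximal \<D> t f) \<le> ennreal (C * Lp_norm (1 / (3 - 2 * t)) (\<lambda>z. v (norm z)) f)"
      unfolding bounded_Lp_weak_L1_def by blast
    define q where "q = (3 - 2 * t) / (2 * t - 2)"
    have q: "q > 0" using t by (simp add: q_def)
    define K where "K = (C * 2 powr (4 - t)) powr (1 / (2 * t - 2))"
    have "2 ^ k * ?J k \<le> ennreal (max K (1 / c powr q))" for k
    proof (cases "k = 0")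
      case True
      (* The lower bound of the weight holds on [0,1/2) only: the end point 1/2 is a null set. *)
      have "?J 0 \<le> (\<integral>\<^sup>+r. ennreal (1 / c powr q) * indicator {0..1/2::real} r \<partial>lebesgue)"
      proof (rule nn_integral_mono_AE)
        have "AE r in lebesgue. r \<noteq> (1/2 :: real)"
          by (rule AE_completion) (rule AE_lborel_singleton)
        then show "AE r in lebesgue. 1 / ennreal (\<omega> r powr ((3 - 2 * t) / (2 * t - 2)))
            * indicator {1 - 1 / 2 ^ 0..1 - 1 / 2 ^ (0 + 1)} r
            \<le> ennreal (1 / c powr q) * indicator {0..1/2} r"
        proof eventually_elim
          case (elim r)
          have "1 / ennreal (\<omega> r powr q) \<le> ennreal (1 / c powr q)" if r: "0 \<le> r" "r < 1/2"
          proof -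
            have "\<omega> r \<ge> c" using r by (intro c) auto
            then have "c powr q \<le> \<omega> r powr q" "\<omega> r > 0" using c(1) q by (auto intro: powr_mono2)
            then show ?thesis
              using c(1) by (simp add: divide_ennreal frac_le flip: ennreal_1)
          qed
          then show ?case using elim unfolding q_def by (auto simp: indicator_def)
        qed
      qed
      also have "\<dots> = ennreal (1 / c powr q) * ennreal (1/2)"
        by (subst nn_integral_cmult_indicator) auto
      also have "\<dots> \<le> ennreal (1 / c powr q)"
      proof -
        have "ennreal (1 / c powr q) * ennreal (1/2) = ennreal (1 / c powr q * (1/2))"
          by (rule ennreal_mult[symmetric]) auto
        also have "\<dots> \<le> ennreal (1 / c powr q)"
          by (intro ennreal_leI mult_left_le) auto
        finally show ?thesis .
      qed
      also have "\<dots> \<le> ennreal (max K (1 / c powr q))" by (intro ennreal_leI) simp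
      finally show ?thesis using True by simp
    next
      case False
      then have "?J k \<le> ennreal (K / 2 ^ k)"
        unfolding J K_def by (intro dual_integral_le[OF D t v nonneg C bound]) auto
      then have "2 ^ k * ?J k \<le> 2 ^ k * ennreal (K / 2 ^ k)" by (rule mult_left_mono) simp
      also have "\<dots> = ennreal K" unfolding two by (simp add: ennreal_mult'[symmetric])
      also have "\<dots> \<le> ennreal (max K (1 / c powr q))" by (intro ennreal_leI) simp
      finally show ?thesis .
    qed
    then have "(SUP k. 2 ^ k * ?J k) \<le> ennreal (max K (1 / c powr q))" by (rule SUP_least)
    then show "(SUP k. 2 ^ k * ?J k) < \<infinity>" by (rule le_less_trans) simp
  next
    assume fin: "(SUP k. 2 ^ k * ?J k) < \<infinity>"
    define a where "a = enn2real (SUP k. 2 ^ k * ?J k)"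
    have a: "(SUP k. 2 ^ k * ?J k) = ennreal a" "a \<ge> 0" using fin by (auto simp: a_def)
    have "?J k \<le> ennreal (a / 2 ^ k)" for k
    proof -
      have "?J k = ennreal (1 / 2 ^ k) * (2 ^ k * ?J k)"
        unfolding two mult.assoc[symmetric] by (simp add: ennreal_mult'[symmetric])
      also have "\<dots> \<le> ennreal (1 / 2 ^ k) * ennreal a"
        unfolding a(1)[symmetric] by (intro mult_left_mono SUP_upper) auto
      finally show ?thesis by (simp add: ennreal_mult'[symmetric])
    qed
    then show "bounded_Lp_weak_L1 (dyadic_maximal \<D> t) (1 / (3 - 2 * t)) (\<lambda>z. v (norm z))"
      unfolding J by (rule weak_bound_sufficient[OF D t a(2) v nonneg])
  qed
qed

end
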